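(* Let $p=p(n)\in[0,1]$ and let $J_{ij}^{(n)}$ be the Jaccard index of any distinct vertices $i,j\in[n]$ in the Erdős–Rényi random graph $G(n,p)$. As $n\to\infty$: (i) If $np^2(1-p)\to\infty$, then $$\sqrt{\frac{n(2-p)^3}{2(1-p)}}\Big(J_{ij}^{(n)}-\frac{p}{2-p}\Big)\longrightarrow Z\quad\text{in distribution},$$ where $Z$ denotes a standard normal random variable. (ii) If $np^2\to\lambda$ for some constant $\lambda>0$, then $2np\,J_{ij}^{(n)}\to\mathrm{Poi}(\lambda)$ in distribution. (iii) If $np^2\to0$, then $np\,J_{ij}^{(n)}\to0$ in probability. (iv) If $n(1-p)\to c$ for some constant $c>0$, then $n(1-J_{ij}^{(n)})\to\mathrm{Poi}(2c)$ in distribution. (v) If $n(1-p)\to0$, then $n(1-J_{ij}^{(n)})\to0$ in probability. Here $\mathrm{Poi}(\mu)$ denotes the Poisson distribution with parameter $\mu$.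
   Context: $G(n,p)$ is the Erdős–Rényi random graph on the vertex set $[n]=\{1,\dots,n\}$, $n\ge 2$, in which each edge is present independently with probability $p=p(n)$, which may depend on $n$. For $i,j\in[n]$, $I_{ij}$ is the indicator that the edge between $i$ and $j$ is present; thus $I_{ii}=0$, $I_{ij}=I_{ji}$, and $\{I_{ij}:1\le i<j\le n\}$ are independent Bernoulli($p$) variables. With $a\vee b=\max(a,b)$, set for $i\ne j$ $$S_{ij}^{(n)}=\sum_{k\in[n],\,k\ne i,j}I_{ik}I_{jk},\qquad T_{ij}^{(n)}=\sum_{k\in[n],\,k\ne i,j}I_{ik}\vee I_{jk}.$$ The Jaccard index of distinct vertices $i,j$ is $J_{ij}^{(n)}=S_{ij}^{(n)}/T_{ij}^{(n)}$ if $T_{ij}^{(n)}>0$, and by convention $J_{ij}^{(n)}=p/(2-p)$ if $T_{ij}^{(n)}=0$. (So it is the number of common neighbours of $i$ and $j$ divided by the number of vertices other than $i,j$ adjacent to at least one of them.) *)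

theory Defs
  imports "HOL-Probability.Probability"
begin

definition possible_edges :: "nat \<Rightarrow> nat set set" where
  "possible_edges n = {e. e \<subseteq> {1..n} \<and> card e = 2}"

text \<open>
  A graph on \<open>{1..n}\<close> is represented by the characteristic function of its edge set;
  \<open>Pi_pmf\<close> makes the edge indicators independent, and \<open>False\<close> outside
  \<open>possible_edges n\<close>. Note that \<open>bernoulli_pmf p\<close> has its intended meaning
  only for \<open>0 \<le> p \<le> 1\<close>.
\<close>

definition erdos_renyi :: "nat \<Rightarrow> real \<Rightarrow> (nat set \<Rightarrow> bool) pmf" where
  "erdos_renyi n p = Pi_pmf (possible_edges n) False (\<lambda>_. bernoulli_pmf p)"

definition edge_ind :: "(nat set \<Rightarrow> bool) \<Rightarrow> nat \<Rightarrow> nat \<Rightarrow> nat" where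
  "edge_ind G i j = of_bool (i \<noteq> j \<and> G {i, j})"

definition common_nbrs :: "nat \<Rightarrow> nat \<Rightarrow> nat \<Rightarrow> (nat set \<Rightarrow> bool) \<Rightarrow> nat" where
  "common_nbrs n i j G = (\<Sum>k\<in>{1..n} - {i, j}. edge_ind G i k * edge_ind G j k)"

definition union_nbrs :: "nat \<Rightarrow> nat \<Rightarrow> nat \<Rightarrow> (nat set \<Rightarrow> bool) \<Rightarrow> nat" where
  "union_nbrs n i j G = (\<Sum>k\<in>{1..n} - {i, j}. max (edge_ind G i k) (edge_ind G j k))"

text \<open>The parameter \<open>p\<close> enters only through the convention for an empty union.\<close>

definition jaccard :: "nat \<Rightarrow> real \<Rightarrow> nat \<Rightarrow> nat \<Rightarrow> (nat set \<Rightarrow> bool) \<Rightarrow> real" where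
  "jaccard n p i j G =
     (if union_nbrs n i j G > 0 then real (common_nbrs n i j G) / real (union_nbrs n i j G)
      else p / (2 - p))"

text \<open>
  In both modes of convergence the \<open>n\<close>-th random variable \<open>X n\<close> lives on its own
  probability space \<open>M n\<close>. The limit in distribution is given by its law.
\<close>

definition conv_in_distr :: "(nat \<Rightarrow> 'a pmf) \<Rightarrow> (nat \<Rightarrow> 'a \<Rightarrow> real) \<Rightarrow> real measure \<Rightarrow> bool" where
  "conv_in_distr M X L \<longleftrightarrow> weak_conv_m (\<lambda>n. distr (measure_pmf (M n)) borel (X n)) L"

definition conv_in_prob :: "(nat \<Rightarrow> 'a pmf) \<Rightarrow> (nat \<Rightarrow> 'a \<Rightarrow> real) \<Rightarrow> real \<Rightarrow> bool" where
  "conv_in_prob M X c \<longleftrightarrow>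
     (\<forall>\<epsilon>>0. (\<lambda>n. measure_pmf.prob (M n) {x. \<bar>X n x - c\<bar> > \<epsilon>}) \<longlonglongrightarrow> 0)"

definition poisson_law :: "real \<Rightarrow> real measure" where
  "poisson_law \<mu> = distr (measure_pmf (poisson_pmf \<mu>)) borel real"

end

theory Submission
  imports Defs
begin

text \<open>
  Over the \<open>n - 2\<close> vertices \<open>k\<close> other than \<open>i, j\<close>, the pairs of edge indicators \<open>(I\<^sub>i\<^sub>k, I\<^sub>j\<^sub>k)\<close> are
  independent and identically distributed, so every sum of a function of these pairs has
  characteristic function \<open>\<phi>\<^bsup>n-2\<^esup>\<close>, and convergence of \<open>n (\<phi> - 1)\<close> to \<open>w\<close> gives the limit \<open>exp w\<close>.
  With \<open>q = p / (2 - p)\<close>, the summands of \<open>S - q T\<close> have mean zero and variance \<open>2 p\<^sup>2 (1 - p) / (2 - p)\<close>,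
  which yields the normal limit; \<open>S\<close> and \<open>T - S\<close> are binomial and yield the Poisson limits. In
  all three cases \<open>T\<close> divided by its approximate mean tends to 1 in probability by a second
  moment bound, and Slutsky's theorem transfers the limit to the Jaccard index. In the two
  degenerate regimes \<open>S = 0\<close>, respectively \<open>S = T\<close>, holds with probability tending to 1.
\<close>

section \<open>Convergence in distribution and in probability\<close>

lemma norm_iexp_diff_le: "norm (iexp a - iexp b) \<le> \<bar>a - b\<bar>" for a b :: real
proof -
  have "iexp a - iexp b = iexp b * (iexp (a - b) - 1)"
    by (simp add: algebra_simps flip: exp_add)
  hence "norm (iexp a - iexp b) = norm (iexp (a - b) - 1)"
    by (simp add: norm_mult)
  also have "\<dots> \<le> \<bar>a - b\<bar>"
    using iexp_approx1[of "a - b" 0] by simp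
  finally show ?thesis .
qed

text \<open>Compare \<open>a n\<close> with \<open>exp (a n - 1)\<close>, whose
  \<open>N n\<close>-th power has the desired limit at once. Both bases lie in the closed unit disc,
  so the powers differ by at most \<open>N n\<close> times the difference of the bases. That
  difference is quadratic in \<open>a n - 1\<close>, and since \<open>N n * (a n - 1)\<close>
  converges, the total error is O(1 / \<open>N n\<close>). This avoids complex logarithms.\<close>

lemma power_tendsto_exp:
  fixes a :: "nat \<Rightarrow> complex" and N :: "nat \<Rightarrow> nat"
  assumes le1: "\<forall>\<^sub>F n in sequentially. norm (a n) \<le> 1"
    and N: "filterlim N at_top sequentially"
    and lim: "(\<lambda>n. of_nat (N n) * (a n - 1)) \<longlonglongrightarrow> w"
  shows "(\<lambda>n. a n ^ N n) \<longlonglongrightarrow> exp w"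
proof -
  have exp_lim: "(\<lambda>n. exp (a n - 1) ^ N n) \<longlonglongrightarrow> exp w"
    using tendsto_exp[OF lim] by (simp add: exp_of_nat_mult)
  have bound: "\<forall>\<^sub>F n in sequentially. norm (a n ^ N n - exp (a n - 1) ^ N n)
      \<le> exp 2 * (norm (of_nat (N n) * (a n - 1))^2 * inverse (real (N n)))"
    using le1 filterlim_at_top[THEN iffD1, OF N, THEN spec, of 1]
  proof eventually_elim
    case (elim n)
    define z where "z = a n - 1"
    \<comment> \<open>The upper bound puts \<open>exp z\<close> in the unit disc; the lower one
      gives \<open>\<bar>Re z\<bar> \<le> 2\<close>, the source of the constant
      \<open>exp 2\<close>.\<close>
    have Re: "Re (a n) \<le> 1" "- 1 \<le> Re (a n)"
      using elim(1) abs_Re_le_cmod[of "a n"] by linarith+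
    have nexp: "norm (exp z) \<le> 1"
      using Re by (simp add: z_def)
    have "norm (a n ^ N n - exp z ^ N n) \<le> real (N n) * norm (a n - exp z)"
      by (rule norm_power_diff[OF elim(1) nexp])
    also have "norm (a n - exp z) = norm (exp z - (\<Sum>k\<le>1. z ^ k / fact k))"
      by (simp add: z_def norm_minus_commute)
    also have "\<dots> \<le> exp \<bar>Re z\<bar> * norm z ^ 2"
      using Taylor_exp[of z 1] by (simp add: numeral_2_eq_2)
    also have "\<dots> \<le> exp 2 * norm z ^ 2"
      using Re by (intro mult_right_mono) (auto simp: z_def)
    also have "real (N n) * (exp 2 * norm z ^ 2)
        = exp 2 * (norm (of_nat (N n) * z)^2 * inverse (real (N n)))"
      using elim(2) by (simp add: norm_mult power2_eq_square)
    finally show ?case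
      by (simp add: z_def mult_left_mono)
  qed
  have "(\<lambda>n. inverse (real (N n))) \<longlonglongrightarrow> 0"
    using N by (intro tendsto_inverse_0_at_top filterlim_compose[OF filterlim_real_sequentially])
  hence "(\<lambda>n. exp 2 * (norm (of_nat (N n) * (a n - 1))^2 * inverse (real (N n))))
      \<longlonglongrightarrow> exp 2 * (norm w ^ 2 * 0)"
    by (intro tendsto_intros lim)
  hence "(\<lambda>n. a n ^ N n - exp (a n - 1) ^ N n) \<longlonglongrightarrow> 0"
    by (intro Lim_null_comparison[OF bound]) simp
  from tendsto_add[OF this exp_lim] show ?thesis by simp
qed

lemma char_distr_pmf:
  "char (distr (measure_pmf M) borel X) t = measure_pmf.expectation M (\<lambda>x. iexp (t * X x))"
  by (simp add: char_def integral_distr)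

lemma real_distribution_distr_pmf: "real_distribution (distr (measure_pmf M) borel X)"
  by (rule prob_space.real_distribution_distr[OF prob_space_measure_pmf]) simp

lemma integrable_iexp_pmf: "integrable (measure_pmf M) (\<lambda>x. iexp (f x))" for f :: "'a \<Rightarrow> real"
  by (rule prob_space.integrable_iexp[OF prob_space_measure_pmf]) simp_all

text \<open>Levy's continuity theorem reduces each limit law to a pointwise limit of characteristic
  functions.\<close>

lemma conv_in_distrI:
  assumes "real_distribution L"
    and "\<And>t. (\<lambda>n. measure_pmf.expectation (M n) (\<lambda>x. iexp (t * X n x))) \<longlonglongrightarrow> char L t"
  shows "conv_in_distr M X L"
  unfolding conv_in_distr_def
  by (intro levy_continuity real_distribution_distr_pmf assms(1)) (unfold char_distr_pmf, rule assms(2))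

text \<open>The function \<open>iexp (t * x)\<close> is bounded by 1 and
  \<open>\<bar>t\<bar>\<close>-Lipschitz in \<open>x\<close>. Hence the integrands for
  \<open>X\<close> and \<open>Y\<close> differ by at most \<open>\<bar>t\<bar> * d\<close> where the
  variables are within \<open>d\<close>, and by at most 2 on the rare remaining event.\<close>

lemma conv_in_distr_slutsky:
  assumes L: "real_distribution L" and X: "conv_in_distr M X L"
    and D: "conv_in_prob M (\<lambda>n x. Y n x - X n x) 0"
  shows "conv_in_distr M Y L"
proof (rule conv_in_distrI[OF L])
  fix t :: real
  let ?E = "\<lambda>n. measure_pmf.expectation (M n)"
  have 1: "(\<lambda>n. ?E n (\<lambda>x. iexp (t * X n x))) \<longlonglongrightarrow> char L t"
    using levy_continuity1[OF real_distribution_distr_pmf L X[unfolded conv_in_distr_def]]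
    by (simp add: char_distr_pmf)
  have "(\<lambda>n. ?E n (\<lambda>x. iexp (t * Y n x)) - ?E n (\<lambda>x. iexp (t * X n x))) \<longlonglongrightarrow> 0"
  proof (rule tendstoI)
    fix e :: real assume e: "e > 0"
    \<comment> \<open>With this \<open>d\<close> the Lipschitz part costs at most
      \<open>e / 2\<close>; a bad event of probability below \<open>e / 4\<close> costs less than
      \<open>e / 2\<close>. The \<open>+ 1\<close> covers \<open>t = 0\<close>.\<close>
    define d where "d = e / (2 * (\<bar>t\<bar> + 1))"
    have d: "d > 0" "\<bar>t\<bar> * d \<le> e / 2"
      using e by (auto simp: d_def field_simps)
    let ?B = "\<lambda>n. {x. \<bar>Y n x - X n x - 0\<bar> > d}"
    have "\<forall>\<^sub>F n in sequentially. measure_pmf.prob (M n) (?B n) < e / 4"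
      using D d(1) e unfolding conv_in_prob_def by (intro order_tendstoD(2)[of _ 0]) auto
    thus "\<forall>\<^sub>F n in sequentially.
        dist (?E n (\<lambda>x. iexp (t * Y n x)) - ?E n (\<lambda>x. iexp (t * X n x))) 0 < e"
    proof eventually_elim
      case (elim n)
      have ind: "integrable (measure_pmf (M n)) (indicator (?B n) :: _ \<Rightarrow> real)"
        by (intro measure_pmf.integrable_const_bound[of _ 1]) (auto simp: indicator_def)
      hence int: "integrable (measure_pmf (M n)) (\<lambda>x. \<bar>t\<bar> * d + 2 * indicator (?B n) x)"
        by simp
      have "norm (?E n (\<lambda>x. iexp (t * Y n x)) - ?E n (\<lambda>x. iexp (t * X n x)))
          = norm (?E n (\<lambda>x. iexp (t * Y n x) - iexp (t * X n x)))"
        by (subst Bochner_Integration.integral_diff) (rule integrable_iexp_pmf refl)+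
      also have "\<dots> \<le> ?E n (\<lambda>x. norm (iexp (t * Y n x) - iexp (t * X n x)))"
        by (rule integral_norm_bound)
      also have "\<dots> \<le> ?E n (\<lambda>x. \<bar>t\<bar> * d + 2 * indicator (?B n) x)"
      proof (rule integral_mono[OF _ int])
        show "integrable (measure_pmf (M n)) (\<lambda>x. norm (iexp (t * Y n x) - iexp (t * X n x)))"
          by (intro integrable_norm Bochner_Integration.integrable_diff integrable_iexp_pmf)
        fix x
        show "norm (iexp (t * Y n x) - iexp (t * X n x)) \<le> \<bar>t\<bar> * d + 2 * indicator (?B n) x"
        proof (cases "x \<in> ?B n")
          case True
          have "norm (iexp (t * Y n x) - iexp (t * X n x)) \<le> 1 + 1"
            by (rule order_trans[OF norm_triangle_ineq4]) simp
          thus ?thesis using True d(1) by (simp add: add_increasing)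
        next
          case False
          have "norm (iexp (t * Y n x) - iexp (t * X n x)) \<le> \<bar>t * Y n x - t * X n x\<bar>"
            by (rule norm_iexp_diff_le)
          also have "\<dots> = \<bar>t\<bar> * \<bar>Y n x - X n x\<bar>"
            by (simp add: abs_mult flip: right_diff_distrib)
          also have "\<dots> \<le> \<bar>t\<bar> * d"
            using False by (intro mult_left_mono) auto
          finally show ?thesis by (simp add: indicator_def)
        qed
      qed
      also have "\<dots> = \<bar>t\<bar> * d + 2 * measure_pmf.prob (M n) (?B n)"
        by (subst Bochner_Integration.integral_add) (use ind in simp_all)
      also have "\<dots> < e" using elim d(2) by simp
      finally show ?case by simp
    qed
  qed
  from tendsto_add[OF this 1] show "(\<lambda>n. ?E n (\<lambda>x. iexp (t * Y n x))) \<longlonglongrightarrow> char L t"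
    by simp
qed

section \<open>Convergence in probability: Markov and Chebyshev bounds, quotients and
  products\<close>

lemma pmf_markov:
  fixes X :: "'a \<Rightarrow> real"
  assumes "integrable (measure_pmf M) (\<lambda>x. \<bar>X x\<bar>)" "c > 0"
  shows "measure_pmf.prob M {x. \<bar>X x\<bar> > c} \<le> measure_pmf.expectation M (\<lambda>x. \<bar>X x\<bar>) / c"
proof -
  have "measure_pmf.prob M {x. \<bar>X x\<bar> > c} \<le> measure_pmf.prob M {x \<in> space (measure_pmf M). \<bar>X x\<bar> \<ge> c}"
    by (intro measure_pmf.finite_measure_mono) auto
  also have "\<dots> \<le> measure_pmf.expectation M (\<lambda>x. \<bar>X x\<bar>) / c"
    using assms by (intro integral_Markov_inequality_measure[where A = "{}"]) auto
  finally show ?thesis .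
qed

text \<open>A union bound: domination by \<open>Z\<close> may fail on exceptional events
  \<open>B n\<close> of vanishing probability, which will absorb the exceptional values of the
  Jaccard index.\<close>

lemma conv_in_prob_squeeze:
  assumes P: "(\<lambda>n. measure_pmf.prob (M n) (B n)) \<longlonglongrightarrow> 0"
    and Z: "conv_in_prob M Z 0"
    and le: "\<forall>\<^sub>F n in sequentially. \<forall>x. x \<notin> B n \<longrightarrow> \<bar>Y n x - c\<bar> \<le> \<bar>Z n x\<bar>"
  shows "conv_in_prob M Y c"
  unfolding conv_in_prob_def
proof safe
  fix e :: real assume e: "e > 0"
  have "(\<lambda>n. measure_pmf.prob (M n) (B n) + measure_pmf.prob (M n) {x. \<bar>Z n x - 0\<bar> > e}) \<longlonglongrightarrow> 0 + 0"
    using Z e by (intro tendsto_add P) (simp add: conv_in_prob_def)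
  moreover have "\<forall>\<^sub>F n in sequentially. norm (measure_pmf.prob (M n) {x. \<bar>Y n x - c\<bar> > e})
      \<le> measure_pmf.prob (M n) (B n) + measure_pmf.prob (M n) {x. \<bar>Z n x - 0\<bar> > e}"
    using le
  proof eventually_elim
    case (elim n)
    have "{x. \<bar>Y n x - c\<bar> > e} \<subseteq> B n \<union> {x. \<bar>Z n x - 0\<bar> > e}"
    proof
      fix x assume "x \<in> {x. \<bar>Y n x - c\<bar> > e}"
      moreover have "x \<notin> B n \<Longrightarrow> \<bar>Y n x - c\<bar> \<le> \<bar>Z n x\<bar>"
        using elim by simp
      ultimately show "x \<in> B n \<union> {x. \<bar>Z n x - 0\<bar> > e}"
        by (cases "x \<in> B n") simp_all
    qed
    hence "measure_pmf.prob (M n) {x. \<bar>Y n x - c\<bar> > e}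
        \<le> measure_pmf.prob (M n) (B n \<union> {x. \<bar>Z n x - 0\<bar> > e})"
      by (intro measure_pmf.finite_measure_mono) auto
    also have "\<dots> \<le> measure_pmf.prob (M n) (B n) + measure_pmf.prob (M n) {x. \<bar>Z n x - 0\<bar> > e}"
      by (intro measure_Un_le) auto
    finally show ?case by simp
  qed
  ultimately show "(\<lambda>n. measure_pmf.prob (M n) {x. \<bar>Y n x - c\<bar> > e}) \<longlonglongrightarrow> 0"
    unfolding add_0_left by (rule Lim_null_comparison[rotated])
qed

text \<open>Chebyshev's inequality centred at the limit \<open>c\<close> instead of the mean, so
  that bias and variance are handled together.\<close>

lemma conv_in_prob_second_moment:
  assumes int: "\<And>n. integrable (measure_pmf (M n)) (\<lambda>x. (Y n x - c)\<^sup>2)"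
    and lim: "(\<lambda>n. measure_pmf.expectation (M n) (\<lambda>x. (Y n x - c)\<^sup>2)) \<longlonglongrightarrow> 0"
  shows "conv_in_prob M Y c"
  unfolding conv_in_prob_def
proof safe
  fix e :: real assume e: "e > 0"
  have bd: "norm (measure_pmf.prob (M n) {x. \<bar>Y n x - c\<bar> > e})
      \<le> measure_pmf.expectation (M n) (\<lambda>x. (Y n x - c)\<^sup>2) / e\<^sup>2" for n
  proof -
    have "\<bar>Y n x - c\<bar> > e \<longleftrightarrow> \<bar>(Y n x - c)\<^sup>2\<bar> > e\<^sup>2" for x
      using e abs_le_square_iff[of "Y n x - c" e] by (simp add: not_le[symmetric] del: not_le)
    thus ?thesis
      using pmf_markov[of "M n" "\<lambda>x. (Y n x - c)\<^sup>2" "e\<^sup>2"] int[of n] e by simp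
  qed
  have "(\<lambda>n. measure_pmf.expectation (M n) (\<lambda>x. (Y n x - c)\<^sup>2) / e\<^sup>2) \<longlonglongrightarrow> 0"
    using tendsto_divide[OF lim tendsto_const[of "e\<^sup>2"]] e by simp
  thus "(\<lambda>n. measure_pmf.prob (M n) {x. \<bar>Y n x - c\<bar> > e}) \<longlonglongrightarrow> 0"
    by (rule Lim_null_comparison[OF always_eventually[OF allI[OF bd]]])
qed

lemma conv_in_prob_const:
  fixes c :: "nat \<Rightarrow> real"
  assumes "c \<longlonglongrightarrow> 0"
  shows "conv_in_prob M (\<lambda>n _. c n) 0"
  using tendsto_power[OF assms, of 2] by (intro conv_in_prob_second_moment) simp_all

lemma conv_in_prob_inverse_1:
  assumes "conv_in_prob M R 1"
  shows "conv_in_prob M (\<lambda>n x. inverse (R n x)) 1"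
  unfolding conv_in_prob_def
proof safe
  fix e :: real assume e: "e > 0"
  \<comment> \<open>The bound \<open>d \<le> 1 / 2\<close> keeps \<open>R n x\<close> above
    \<open>1 / 2\<close>, so inversion at most doubles the distance to 1; then
    \<open>2 * d \<le> e\<close> finishes.\<close>
  define d where "d = min (e / 2) (1 / 2)"
  have d: "d > 0" "d \<le> e / 2" "d \<le> 1 / 2" using e by (auto simp: d_def)
  have sub: "{x. \<bar>inverse (R n x) - 1\<bar> > e} \<subseteq> {x. \<bar>R n x - 1\<bar> > d}" for n
  proof (safe, rule ccontr)
    fix x assume *: "\<bar>inverse (R n x) - 1\<bar> > e" "\<not> \<bar>R n x - 1\<bar> > d"
    have R: "R n x \<ge> 1 / 2" "\<bar>R n x - 1\<bar> \<le> d" using *(2) d by linarith+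
    have "\<bar>inverse (R n x) - 1\<bar> = \<bar>R n x - 1\<bar> / R n x"
      using R by (simp add: field_simps abs_if)
    also have "\<dots> \<le> d / (1 / 2)" using R d by (intro frac_le) auto
    finally show False using * d by simp
  qed
  have "(\<lambda>n. measure_pmf.prob (M n) {x. \<bar>R n x - 1\<bar> > d}) \<longlonglongrightarrow> 0"
    using assms d unfolding conv_in_prob_def by auto
  thus "(\<lambda>n. measure_pmf.prob (M n) {x. \<bar>inverse (R n x) - 1\<bar> > e}) \<longlonglongrightarrow> 0"
    by (rule tendsto_sandwich[OF _ _ tendsto_const, rotated 2])
       (auto intro!: always_eventually measure_pmf.finite_measure_mono sub)
qed

text \<open>By Markov's inequality the L1 bound makes \<open>X\<close> tight: outside an event of
  probability at most \<open>C / K\<close> it is bounded by \<open>K\<close>, and a bounded factor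
  cannot prevent the product from vanishing with \<open>R - c\<close>.\<close>

lemma conv_in_prob_mult_bounded:
  assumes int: "\<And>n. integrable (measure_pmf (M n)) (\<lambda>x. \<bar>X n x\<bar>)"
    and bd: "\<forall>\<^sub>F n in sequentially. measure_pmf.expectation (M n) (\<lambda>x. \<bar>X n x\<bar>) \<le> C"
    and R: "conv_in_prob M R c"
  shows "conv_in_prob M (\<lambda>n x. X n x * (R n x - c)) 0"
  unfolding conv_in_prob_def
proof safe
  fix e :: real assume e: "e > 0"
  have C: "C \<ge> 0"
  proof -
    obtain n where "measure_pmf.expectation (M n) (\<lambda>x. \<bar>X n x\<bar>) \<le> C"
      using eventually_happens'[OF sequentially_bot bd] by blast
    moreover have "0 \<le> measure_pmf.expectation (M n) (\<lambda>x. \<bar>X n x\<bar>)"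
      by (rule Bochner_Integration.integral_nonneg) simp
    ultimately show ?thesis by linarith
  qed
  show "(\<lambda>n. measure_pmf.prob (M n) {x. \<bar>X n x * (R n x - c) - 0\<bar> > e}) \<longlonglongrightarrow> 0"
  proof (rule tendstoI)
    fix d :: real assume d: "d > 0"
    \<comment> \<open>Chosen to make \<open>C / K\<close> less than \<open>d / 2\<close>; the
      \<open>+ 1\<close> keeps \<open>K\<close> positive when \<open>C = 0\<close>.\<close>
    define K where "K = 2 * (C + 1) / d"
    have K: "K > 0" "C / K < d / 2" using C d by (simp_all add: K_def field_simps)
    have "\<forall>\<^sub>F n in sequentially. measure_pmf.prob (M n) {x. \<bar>R n x - c\<bar> > e / K} < d / 2"
    proof (rule order_tendstoD(2)[of _ 0])
      show "(\<lambda>n. measure_pmf.prob (M n) {x. \<bar>R n x - c\<bar> > e / K}) \<longlonglongrightarrow> 0"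
        using R e K(1) by (simp add: conv_in_prob_def)
    qed (use d in simp)
    with bd show "\<forall>\<^sub>F n in sequentially.
        dist (measure_pmf.prob (M n) {x. \<bar>X n x * (R n x - c) - 0\<bar> > e}) 0 < d"
    proof eventually_elim
      case (elim n)
      have "{x. \<bar>X n x * (R n x - c) - 0\<bar> > e} \<subseteq> {x. \<bar>X n x\<bar> > K} \<union> {x. \<bar>R n x - c\<bar> > e / K}"
      proof (safe, rule ccontr)
        fix x assume *: "\<bar>X n x * (R n x - c) - 0\<bar> > e" "\<not> \<bar>R n x - c\<bar> > e / K" "\<not> \<bar>X n x\<bar> > K"
        have "\<bar>X n x * (R n x - c)\<bar> \<le> K * (e / K)"
          unfolding abs_mult using *(2,3) K(1) by (intro mult_mono) linarith+
        thus False using *(1) K(1) by simp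
      qed
      hence "measure_pmf.prob (M n) {x. \<bar>X n x * (R n x - c) - 0\<bar> > e}
          \<le> measure_pmf.prob (M n) ({x. \<bar>X n x\<bar> > K} \<union> {x. \<bar>R n x - c\<bar> > e / K})"
        by (intro measure_pmf.finite_measure_mono) auto
      also have "\<dots> \<le> measure_pmf.prob (M n) {x. \<bar>X n x\<bar> > K}
          + measure_pmf.prob (M n) {x. \<bar>R n x - c\<bar> > e / K}"
        by (intro measure_Un_le) auto
      also have "measure_pmf.prob (M n) {x. \<bar>X n x\<bar> > K} \<le> C / K"
        using pmf_markov[OF int K(1), of n] divide_right_mono[OF elim(1), of K] K(1) by linarith
      finally have "measure_pmf.prob (M n) {x. \<bar>X n x * (R n x - c) - 0\<bar> > e} < d"
        using elim(2) K(2) by linarith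
      thus ?case by simp
    qed
  qed
qed

text \<open>Off \<open>B n\<close> the difference \<open>Y - X\<close> equals
  \<open>X * (R - 1)\<close>, which tends to 0 in probability; the values of \<open>Y\<close> on
  \<open>B n\<close> are arbitrary.\<close>

lemma conv_in_distr_mult:
  assumes L: "real_distribution L" and X: "conv_in_distr M X L"
    and int: "\<And>n. integrable (measure_pmf (M n)) (\<lambda>x. \<bar>X n x\<bar>)"
    and bd: "\<forall>\<^sub>F n in sequentially. measure_pmf.expectation (M n) (\<lambda>x. \<bar>X n x\<bar>) \<le> C"
    and R: "conv_in_prob M R 1"
    and P: "(\<lambda>n. measure_pmf.prob (M n) (B n)) \<longlonglongrightarrow> 0"
    and eq: "\<forall>\<^sub>F n in sequentially. \<forall>x. x \<notin> B n \<longrightarrow> Y n x = X n x * R n x"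
  shows "conv_in_distr M Y L"
proof (rule conv_in_distr_slutsky[OF L X])
  show "conv_in_prob M (\<lambda>n x. Y n x - X n x) 0"
    using eq
    by (intro conv_in_prob_squeeze[OF P conv_in_prob_mult_bounded[OF int bd R]])
       (auto elim!: eventually_mono simp: algebra_simps)
qed

text \<open>Integrating \<open>iexp (t * k)\<close> against the Poisson weights gives
  \<open>exp (- \<mu>)\<close> times the exponential series at
  \<open>\<mu> * iexp t\<close>.\<close>

lemma char_poisson_law:
  assumes "\<mu> > 0"
  shows "char (poisson_law \<mu>) t = exp (of_real \<mu> * (iexp t - 1))"
proof -
  let ?f = "\<lambda>k::nat. pmf (poisson_pmf \<mu>) k *\<^sub>R iexp (t * real k)"
  have int: "integrable (count_space UNIV) ?f"
    using integrable_iexp_pmf[of "poisson_pmf \<mu>" "\<lambda>k. t * real k"]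
    unfolding measure_pmf_eq_density[of "poisson_pmf \<mu>"]
    by (subst (asm) integrable_density) auto
  have "measure_pmf.expectation (poisson_pmf \<mu>) (\<lambda>k. iexp (t * real k)) = integral\<^sup>L (count_space UNIV) ?f"
    unfolding measure_pmf_eq_density[of "poisson_pmf \<mu>"] by (subst integral_density) auto
  with sums_integral_count_space_nat[OF int]
  have 1: "?f sums char (poisson_law \<mu>) t"
    unfolding poisson_law_def char_distr_pmf by simp
  have "(\<lambda>k. exp (- of_real \<mu>) * ((of_real \<mu> * iexp t) ^ k /\<^sub>R fact k))
      sums (exp (- of_real \<mu>) * exp (of_real \<mu> * iexp t))"
    by (intro sums_mult exp_converges)
  also have "(\<lambda>k. exp (- of_real \<mu>) * ((of_real \<mu> * iexp t) ^ k /\<^sub>R fact k)) = ?f"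
  proof
    fix k
    have "iexp t ^ k = iexp (t * real k)"
      using exp_of_nat_mult[of k "\<i> * of_real t"] by (simp add: mult_ac)
    moreover have "complex_of_real (exp (- \<mu>)) = exp (- of_real \<mu>)"
      by (metis exp_of_real of_real_minus)
    ultimately show "exp (- of_real \<mu>) * ((of_real \<mu> * iexp t) ^ k /\<^sub>R fact k) = ?f k"
      using assms by (simp add: power_mult_distrib scaleR_conv_of_real field_simps)
  qed
  finally have "char (poisson_law \<mu>) t = exp (- of_real \<mu>) * exp (of_real \<mu> * iexp t)"
    using 1 by (simp add: sums_unique2)
  thus ?thesis by (simp add: algebra_simps flip: exp_add)
qed

lemma real_distribution_poisson_law: "real_distribution (poisson_law \<mu>)"
  unfolding poisson_law_def by (rule real_distribution_distr_pmf)

section \<open>Neighbourhood sums in the Erdos-Renyi graph\<close>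

text \<open>Induction on the index set: the cross term between a new summand and the old sum
  factorises by independence, and the mean of the new summand is 0.\<close>

lemma expectation_sum_square_indep:
  fixes X :: "'i \<Rightarrow> 'a \<Rightarrow> real"
  assumes fin: "finite (set_pmf M)"
    and indep: "prob_space.indep_vars (measure_pmf M) (\<lambda>_. borel) X A"
    and mean: "\<And>i. i \<in> A \<Longrightarrow> measure_pmf.expectation M (X i) = 0"
  shows "measure_pmf.expectation M (\<lambda>x. (\<Sum>i\<in>A. X i x)\<^sup>2)
    = (\<Sum>i\<in>A. measure_pmf.expectation M (\<lambda>x. (X i x)\<^sup>2))"
  using indep mean
proof (induction A rule: infinite_finite_induct)
  case (insert a A)
  note int = integrable_measure_pmf_finite[OF fin]
  note ps = prob_space_measure_pmf[of M]
  have IH: "measure_pmf.expectation M (\<lambda>x. (\<Sum>i\<in>A. X i x)\<^sup>2)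
      = (\<Sum>i\<in>A. measure_pmf.expectation M (\<lambda>x. (X i x)\<^sup>2))"
    by (rule insert.IH) (use insert.prems prob_space.indep_vars_subset[OF ps insert.prems(1)] in auto)
  have "measure_pmf.expectation M (\<lambda>x. X a x * (\<Sum>i\<in>A. X i x))
      = measure_pmf.expectation M (X a) * measure_pmf.expectation M (\<lambda>x. \<Sum>i\<in>A. X i x)"
    by (intro prob_space.indep_var_lebesgue_integral[OF ps] int
        prob_space.indep_vars_sum[OF ps] insert)
  hence "measure_pmf.expectation M (\<lambda>x. X a x * (\<Sum>i\<in>A. X i x)) = 0"
    using insert.prems(2) by simp
  thus ?case
    using insert.hyps IH by (simp add: power2_sum int mult.assoc)
qed simp_all

text \<open>The expectation of \<open>h A B\<close> for independent Bernoulli(\<open>p\<close>)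
  variables \<open>A\<close> and \<open>B\<close>, written out over the four outcomes so that
  moments become polynomials in \<open>p\<close>. Vector values allow both real moments and complex
  characteristic functions.\<close>

definition edge_pair_mean :: "real \<Rightarrow> (nat \<Rightarrow> nat \<Rightarrow> 'b) \<Rightarrow> 'b::real_vector" where
  "edge_pair_mean p h = (1 - p)\<^sup>2 *\<^sub>R h 0 0 + (p * (1 - p)) *\<^sub>R (h 1 0 + h 0 1) + p\<^sup>2 *\<^sub>R h 1 1"

text \<open>A common form for \<open>S\<close>, \<open>T - S\<close> and the centred, rescaled
  \<open>S - q T\<close>.\<close>

definition nbr_sum :: "nat \<Rightarrow> nat \<Rightarrow> nat \<Rightarrow> (nat \<Rightarrow> nat \<Rightarrow> 'b) \<Rightarrow> (nat set \<Rightarrow> bool) \<Rightarrow> 'b::comm_monoid_add" where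
  "nbr_sum n i j f G = (\<Sum>k\<in>{1..n} - {i, j}. f (edge_ind G i k) (edge_ind G j k))"

section \<open>Joint law and independence of the edge indicators\<close>

lemma finite_possible_edges: "finite (possible_edges n)"
  unfolding possible_edges_def by (rule finite_subset[of _ "Pow {1..n}"]) auto

lemma doubleton_possible_edge:
  "a \<in> {1..n} \<Longrightarrow> b \<in> {1..n} \<Longrightarrow> a \<noteq> b \<Longrightarrow> {a, b} \<in> possible_edges n"
  by (auto simp: possible_edges_def)

lemma finite_set_erdos_renyi: "finite (set_pmf (erdos_renyi n p))"
  unfolding erdos_renyi_def by (simp add: set_Pi_pmf finite_possible_edges finite_PiE_dflt)

lemmas integrable_erdos_renyi = integrable_measure_pmf_finite[OF finite_set_erdos_renyi]

text \<open>Marginalise the product to the two coordinates, then split off one of them.\<close>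

lemma Pi_pmf_pair_component:
  assumes "finite A" "a \<in> A" "b \<in> A" "a \<noteq> b"
  shows "map_pmf (\<lambda>f. (f a, f b)) (Pi_pmf A d q) = pair_pmf (q a) (q b)"
proof -
  have "map_pmf (\<lambda>f. (f a, f b)) (Pi_pmf A d q) = map_pmf (\<lambda>f. (f a, f b)) (Pi_pmf (insert a {b}) d q)"
    using assms by (subst Pi_pmf_subset[of A]) (auto simp: pmf.map_comp o_def)
  also have "\<dots> = map_pmf (\<lambda>(y, f). (y, f b)) (pair_pmf (q a) (Pi_pmf {b} d q))"
    using assms by (subst Pi_pmf_insert) (auto simp: pmf.map_comp o_def case_prod_beta' intro!: map_pmf_cong)
  also have "\<dots> = map_pmf (\<lambda>(y, f). (y, f b)) (map_pmf (\<lambda>(y, z). (y, \<lambda>x. if x = b then z else d)) (pair_pmf (q a) (q b)))"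
    by (simp add: Pi_pmf_singleton pair_map_pmf2 apsnd_def map_prod_def id_def)
  also have "\<dots> = pair_pmf (q a) (q b)"
    by (simp add: pmf.map_comp o_def case_prod_beta')
  finally show ?thesis .
qed

lemma expectation_edge_pair:
  fixes h :: "nat \<Rightarrow> nat \<Rightarrow> 'b::{banach, second_countable_topology}"
  assumes "i \<in> {1..n}" "j \<in> {1..n}" "i \<noteq> j" "k \<in> {1..n} - {i, j}" "0 \<le> p" "p \<le> 1"
  shows "measure_pmf.expectation (erdos_renyi n p) (\<lambda>G. h (edge_ind G i k) (edge_ind G j k))
    = edge_pair_mean p h"
proof -
  \<comment> \<open>The two edges at \<open>k\<close> are distinct because
    \<open>i \<noteq> j\<close>, so their indicators are independent.\<close>
  have "{i, k} \<noteq> {j, k}" using assms by (auto simp: doubleton_eq_iff)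
  hence *: "map_pmf (\<lambda>G. (G {i, k}, G {j, k})) (erdos_renyi n p)
      = pair_pmf (bernoulli_pmf p) (bernoulli_pmf p)"
    unfolding erdos_renyi_def using assms
    by (intro Pi_pmf_pair_component finite_possible_edges doubleton_possible_edge) auto
  have "measure_pmf.expectation (erdos_renyi n p) (\<lambda>G. h (edge_ind G i k) (edge_ind G j k))
      = measure_pmf.expectation (map_pmf (\<lambda>G. (G {i, k}, G {j, k})) (erdos_renyi n p))
          (\<lambda>(x, y). h (of_bool x) (of_bool y))"
    using assms by (simp add: edge_ind_def)
  also have "\<dots> = (\<Sum>z\<in>UNIV \<times> UNIV. pmf (pair_pmf (bernoulli_pmf p) (bernoulli_pmf p)) z *\<^sub>R
      (case z of (x, y) \<Rightarrow> h (of_bool x) (of_bool y)))"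
    unfolding * by (rule integral_measure_pmf) auto
  also have "\<dots> = edge_pair_mean p h"
    using assms
    by (simp add: UNIV_bool pmf_pair edge_pair_mean_def power2_eq_square scaleR_add_right mult.commute flip: sum.cartesian_product)
  finally show ?thesis .
qed

text \<open>For different \<open>k\<close> outside \<open>{i, j}\<close> the blocks
  \<open>{{i, k}, {j, k}}\<close> share no edge. Restrictions of a product measure to disjoint
  blocks are independent, and the \<open>k\<close>-th variable depends only on its own
  block.\<close>

lemma indep_vars_edge_pairs:
  fixes f :: "nat \<Rightarrow> nat \<Rightarrow> real"
  assumes "i \<in> {1..n}" "j \<in> {1..n}" "i \<noteq> j"
  shows "prob_space.indep_vars (measure_pmf (erdos_renyi n p)) (\<lambda>_. borel)
    (\<lambda>k G. f (edge_ind G i k) (edge_ind G j k)) ({1..n} - {i, j})"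
proof -
  note ps = prob_space_measure_pmf[of "erdos_renyi n p"]
  let ?K = "{1..n} - {i, j}"
  let ?e = "\<lambda>k. {{i, k}, {j, k}}"
  have disj: "disjoint_family_on ?e ?K"
    using assms(3) by (auto simp: disjoint_family_on_def doubleton_eq_iff)
  have "prob_space.indep_vars (measure_pmf (erdos_renyi n p)) (\<lambda>k. PiM (?e k) (\<lambda>_. count_space UNIV))
      (\<lambda>k G. restrict G (?e k)) ?K"
    using prob_space.indep_vars_restrict[OF ps
        indep_vars_Pi_pmf[OF finite_possible_edges, of n False "\<lambda>_. bernoulli_pmf p",
          folded erdos_renyi_def] _ disj]
    using assms doubleton_possible_edge by auto
  hence "prob_space.indep_vars (measure_pmf (erdos_renyi n p)) (\<lambda>_. borel)
      (\<lambda>k G. (\<lambda>g. f (of_bool (g {i, k})) (of_bool (g {j, k}))) (restrict G (?e k))) ?K"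
  proof (rule prob_space.indep_vars_compose2[OF ps])
    fix k
    have [measurable]: "(\<lambda>g. g {i, k}) \<in> measurable (PiM (?e k) (\<lambda>_. count_space UNIV)) (count_space (UNIV :: bool set))"
      "(\<lambda>g. g {j, k}) \<in> measurable (PiM (?e k) (\<lambda>_. count_space UNIV)) (count_space (UNIV :: bool set))"
      by (auto intro: measurable_component_singleton)
    \<comment> \<open>Written as a finite case distinction, \<open>f\<close> of the two bits is
      measurable with no condition on \<open>f\<close>.\<close>
    have "(\<lambda>g. f (of_bool (g {i, k})) (of_bool (g {j, k}))) = (\<lambda>g. if g {i, k} then
        (if g {j, k} then f 1 1 else f 1 0) else (if g {j, k} then f 0 1 else f 0 0))"
      by auto
    also have "\<dots> \<in> borel_measurable (PiM (?e k) (\<lambda>_. count_space UNIV))"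
      by measurable
    finally show "(\<lambda>g. f (of_bool (g {i, k})) (of_bool (g {j, k})))
        \<in> borel_measurable (PiM (?e k) (\<lambda>_. count_space UNIV))" .
  qed
  thus ?thesis
    by (rule prob_space.indep_vars_cong[OF ps, THEN iffD1, rotated -1])
       (use assms in \<open>auto simp: edge_ind_def fun_eq_iff\<close>)
qed

section \<open>Moments and characteristic functions of neighbourhood sums\<close>

lemma card_other_vertices:
  assumes "i \<in> {1..n}" "j \<in> {1..n}" "i \<noteq> j"
  shows "card ({1..n} - {i, j}) = n - 2"
  using assms by (subst card_Diff_subset) auto

context
  fixes n i j :: nat and p :: real
  assumes ij: "i \<in> {1..n}" "j \<in> {1..n}" "i \<noteq> j" and p: "0 \<le> p" "p \<le> 1"
begin

lemma expectation_nbr_sum: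
  fixes f :: "nat \<Rightarrow> nat \<Rightarrow> real"
  shows "measure_pmf.expectation (erdos_renyi n p) (nbr_sum n i j f) = real (n - 2) * edge_pair_mean p f"
  unfolding nbr_sum_def[abs_def]
  by (subst Bochner_Integration.integral_sum)
     (simp_all add: integrable_erdos_renyi expectation_edge_pair[OF ij _ p] card_other_vertices[OF ij, unfolded One_nat_def])

lemma char_nbr_sum:
  fixes f :: "nat \<Rightarrow> nat \<Rightarrow> real"
  shows "measure_pmf.expectation (erdos_renyi n p) (\<lambda>G. iexp (t * nbr_sum n i j f G))
    = edge_pair_mean p (\<lambda>a b. iexp (t * f a b)) ^ (n - 2)"
proof -
  have "char (distr (measure_pmf (erdos_renyi n p)) borel (nbr_sum n i j f)) t
      = (\<Prod>k\<in>{1..n} - {i, j}. char (distr (measure_pmf (erdos_renyi n p)) borel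
          (\<lambda>G. f (edge_ind G i k) (edge_ind G j k))) t)"
    unfolding nbr_sum_def[abs_def]
    by (rule prob_space.char_distr_sum[OF prob_space_measure_pmf indep_vars_edge_pairs[OF ij]])
  also have "\<dots> = edge_pair_mean p (\<lambda>a b. iexp (t * f a b)) ^ (n - 2)"
    unfolding char_distr_pmf card_other_vertices[OF ij, symmetric] prod_constant[symmetric]
    by (intro prod.cong refl expectation_edge_pair[where h = "\<lambda>a b. iexp (t * f a b)"] ij p)
  finally show ?thesis unfolding char_distr_pmf .
qed

lemma second_moment_nbr_sum:
  fixes f :: "nat \<Rightarrow> nat \<Rightarrow> real"
  assumes "edge_pair_mean p f = 0"
  shows "measure_pmf.expectation (erdos_renyi n p) (\<lambda>G. (nbr_sum n i j f G)\<^sup>2)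
    = real (n - 2) * edge_pair_mean p (\<lambda>a b. (f a b)\<^sup>2)"
proof -
  have "measure_pmf.expectation (erdos_renyi n p) (\<lambda>G. (nbr_sum n i j f G)\<^sup>2)
      = (\<Sum>k\<in>{1..n} - {i, j}. measure_pmf.expectation (erdos_renyi n p)
          (\<lambda>G. (f (edge_ind G i k) (edge_ind G j k))\<^sup>2))"
    unfolding nbr_sum_def
    by (intro expectation_sum_square_indep finite_set_erdos_renyi indep_vars_edge_pairs ij)
       (simp add: expectation_edge_pair[OF ij _ p] assms)
  also have "\<dots> = (\<Sum>k\<in>{1..n} - {i, j}. edge_pair_mean p (\<lambda>a b. (f a b)\<^sup>2))"
    by (intro sum.cong refl expectation_edge_pair[where h = "\<lambda>a b. (f a b)\<^sup>2"] ij p)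
  finally show ?thesis by (simp add: card_other_vertices[OF ij, unfolded One_nat_def])
qed

text \<open>A bias-variance decomposition: \<open>T / a - 1\<close> is the centred
  \<open>(T - m) / a\<close> plus the constant \<open>m / a - 1\<close>. The variance of
  \<open>T\<close> is at most its mean \<open>m\<close>, as for any sum of independent indicators.
  The bound is arranged for the limit \<open>m / a\<close> to 1 and \<open>inverse a\<close> to
  0.\<close>

lemma second_moment_union_nbrs:
  assumes "a > 0"
  defines "m \<equiv> real (n - 2) * (p * (2 - p))"
  shows "measure_pmf.expectation (erdos_renyi n p) (\<lambda>G. (real (union_nbrs n i j G) / a - 1)\<^sup>2)
    \<le> m / a * inverse a + (m / a - 1)\<^sup>2"
proof -
  \<comment> \<open>\<open>q = 1 - (1 - p)\<^sup>2\<close> is the probability that a vertex is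
    adjacent to \<open>i\<close> or \<open>j\<close>.\<close>
  define q where "q = p * (2 - p)"
  let ?E = "measure_pmf.expectation (erdos_renyi n p)"
  let ?f = "\<lambda>a b. real (max a b) - q"
  let ?X = "nbr_sum n i j ?f"
  have X: "?X G = real (union_nbrs n i j G) - m" for G
    using ij by (simp add: nbr_sum_def union_nbrs_def sum_subtractf card_other_vertices q_def m_def)
  have mean0: "edge_pair_mean p ?f = 0"
    by (simp add: edge_pair_mean_def q_def field_simps power2_eq_square)
  have EX: "?E ?X = 0"
    using mean0 by (simp add: expectation_nbr_sum)
  have "edge_pair_mean p (\<lambda>a b. (?f a b)\<^sup>2) = q - q\<^sup>2"
    by (simp add: edge_pair_mean_def q_def field_simps power2_eq_square)
  also have "\<dots> \<le> q" by simp
  finally have EX2: "?E (\<lambda>G. (?X G)\<^sup>2) \<le> m"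
    unfolding second_moment_nbr_sum[OF mean0] m_def q_def[symmetric]
    by (rule mult_left_mono) simp
  have "?E (\<lambda>G. (real (union_nbrs n i j G) / a - 1)\<^sup>2)
      = ?E (\<lambda>G. (?X G)\<^sup>2 / a\<^sup>2 + (2 * (m / a - 1) / a * ?X G + (m / a - 1)\<^sup>2))"
    using assms(1) unfolding X
    by (intro Bochner_Integration.integral_cong refl) (simp add: field_simps power2_eq_square)
  also have "\<dots> = ?E (\<lambda>G. (?X G)\<^sup>2) / a\<^sup>2 + (m / a - 1)\<^sup>2"
    using EX by (simp add: integrable_erdos_renyi)
  also have "\<dots> \<le> m / a\<^sup>2 + (m / a - 1)\<^sup>2"
    using EX2 by (simp add: divide_right_mono)
  finally show ?thesis by (simp add: power2_eq_square field_simps)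
qed

end

section \<open>Calculus of \<open>edge_pair_mean\<close> and its second-order expansion\<close>

lemma edge_pair_mean_mono:
  fixes f g :: "nat \<Rightarrow> nat \<Rightarrow> real"
  assumes "0 \<le> p" "p \<le> 1" "\<And>a b. a \<in> {0, 1} \<Longrightarrow> b \<in> {0, 1} \<Longrightarrow> f a b \<le> g a b"
  shows "edge_pair_mean p f \<le> edge_pair_mean p g"
  unfolding edge_pair_mean_def real_scaleR_def
  using assms by (intro add_mono mult_left_mono) auto

lemma norm_edge_pair_mean_le:
  fixes h :: "nat \<Rightarrow> nat \<Rightarrow> 'b::real_normed_vector"
  assumes "0 \<le> p" "p \<le> 1"
  shows "norm (edge_pair_mean p h) \<le> edge_pair_mean p (\<lambda>a b. norm (h a b))"
proof -
  have "norm (edge_pair_mean p h) \<le> norm ((1 - p)\<^sup>2 *\<^sub>R h 0 0) + norm ((p * (1 - p)) *\<^sub>R (h 1 0 + h 0 1))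
      + norm (p\<^sup>2 *\<^sub>R h 1 1)"
    unfolding edge_pair_mean_def by (intro norm_triangle_mono order_refl norm_triangle_ineq)
  also have "\<dots> \<le> edge_pair_mean p (\<lambda>a b. norm (h a b))"
    using assms unfolding edge_pair_mean_def
    by (intro add_mono) (auto simp: mult_left_mono norm_triangle_ineq)
  finally show ?thesis .
qed

lemma edge_pair_mean_const [simp]: "edge_pair_mean p (\<lambda>_ _. c) = c"
proof -
  have "edge_pair_mean p (\<lambda>_ _. c) = ((1 - p)\<^sup>2 + p * (1 - p) * 2 + p\<^sup>2) *\<^sub>R c"
    by (simp add: edge_pair_mean_def scaleR_add_left scaleR_2 flip: scaleR_scaleR)
  also have "(1 - p)\<^sup>2 + p * (1 - p) * 2 + p\<^sup>2 = 1"
    by (simp add: power2_eq_square algebra_simps)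
  finally show ?thesis by simp
qed

lemma edge_pair_mean_add:
  "edge_pair_mean p (\<lambda>a b. f a b + g a b) = edge_pair_mean p f + edge_pair_mean p g"
  by (simp add: edge_pair_mean_def scaleR_add_right)

lemma edge_pair_mean_cmult:
  fixes c :: "'b::real_algebra"
  shows "edge_pair_mean p (\<lambda>a b. c * f a b) = c * edge_pair_mean p f"
  by (simp add: edge_pair_mean_def distrib_left)

lemma edge_pair_mean_of_real:
  "edge_pair_mean p (\<lambda>a b. of_real (f a b)) = (of_real (edge_pair_mean p f) :: 'b::real_algebra_1)"
  by (simp add: edge_pair_mean_def scaleR_conv_of_real)

lemma norm_edge_pair_mean_iexp_le_1:
  fixes f :: "nat \<Rightarrow> nat \<Rightarrow> real"
  assumes "0 \<le> p" "p \<le> 1"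
  shows "norm (edge_pair_mean p (\<lambda>a b. iexp (f a b))) \<le> 1"
  using norm_edge_pair_mean_le[OF assms, of "\<lambda>a b. iexp (f a b)"] by simp

text \<open>Expand \<open>iexp\<close> to second order: the linear term vanishes by centring and the
  quadratic one yields \<open>v\<close>. In the cubic remainder one factor
  \<open>\<bar>f a b\<bar>\<close> is bounded by \<open>B\<close>, which leaves \<open>B\<close>
  times the variance, so small summands make the error negligible against \<open>v\<close>.\<close>

lemma edge_pair_mean_iexp_approx:
  fixes f :: "nat \<Rightarrow> nat \<Rightarrow> real"
  assumes p: "0 \<le> p" "p \<le> 1" and mean: "edge_pair_mean p f = 0"
    and bd: "\<And>a b. a \<in> {0, 1} \<Longrightarrow> b \<in> {0, 1} \<Longrightarrow> \<bar>f a b\<bar> \<le> B"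
  defines "v \<equiv> edge_pair_mean p (\<lambda>a b. (f a b)\<^sup>2)"
  shows "norm (edge_pair_mean p (\<lambda>a b. iexp (t * f a b)) - 1 + of_real (t\<^sup>2 * v / 2)) \<le> \<bar>t\<bar> ^ 3 * B / 6 * v"
proof -
  let ?r = "\<lambda>x. iexp x - (1 + \<i> * x - x\<^sup>2 / 2)"
  have r: "norm (?r x) \<le> \<bar>x\<bar> ^ 3 / 6" for x :: real
    using iexp_approx1[of x 2] by (simp add: numeral_eq_Suc algebra_simps fact_numeral)
  have "edge_pair_mean p (\<lambda>a b. iexp (t * f a b)) = edge_pair_mean p (\<lambda>a b. ?r (t * f a b) +
      (1 + (\<i> * t * of_real (f a b) + (- of_real (t\<^sup>2) / 2) * of_real ((f a b)\<^sup>2))))"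
    by (simp add: power_mult_distrib algebra_simps)
  also have "\<dots> = edge_pair_mean p (\<lambda>a b. ?r (t * f a b)) + (1 + (0 + (- of_real (t\<^sup>2) / 2) * of_real v))"
    unfolding edge_pair_mean_add edge_pair_mean_cmult edge_pair_mean_of_real edge_pair_mean_const mean v_def
    by simp
  finally have "norm (edge_pair_mean p (\<lambda>a b. iexp (t * f a b)) - 1 + of_real (t\<^sup>2 * v / 2))
      = norm (edge_pair_mean p (\<lambda>a b. ?r (t * f a b)))"
    by simp
  also have "\<dots> \<le> edge_pair_mean p (\<lambda>a b. norm (?r (t * f a b)))"
    by (rule norm_edge_pair_mean_le[OF p])
  also have "\<dots> \<le> edge_pair_mean p (\<lambda>a b. \<bar>t\<bar> ^ 3 * B / 6 * (f a b)\<^sup>2)"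
  proof (rule edge_pair_mean_mono[OF p])
    fix a b :: nat assume ab: "a \<in> {0, 1}" "b \<in> {0, 1}"
    have "norm (?r (t * f a b)) \<le> \<bar>t\<bar> ^ 3 * (\<bar>f a b\<bar> * (f a b)\<^sup>2) / 6"
      using r[of "t * f a b"] by (simp add: abs_mult power_mult_distrib numeral_eq_Suc mult_ac)
    also have "\<dots> \<le> \<bar>t\<bar> ^ 3 * (B * (f a b)\<^sup>2) / 6"
      using bd[OF ab] by (intro divide_right_mono mult_left_mono mult_right_mono) auto
    finally show "norm (?r (t * f a b)) \<le> \<bar>t\<bar> ^ 3 * B / 6 * (f a b)\<^sup>2"
      by (simp add: mult_ac)
  qed
  also have "\<dots> = \<bar>t\<bar> ^ 3 * B / 6 * v"
    unfolding edge_pair_mean_cmult v_def ..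
  finally show ?thesis .
qed

section \<open>Passing between \<open>n - 2\<close> and \<open>n\<close>, and indicator forms of the
  counts\<close>

lemma tendsto_minus_2_ratio: "(\<lambda>n. real (n - 2) / real n) \<longlonglongrightarrow> 1"
proof -
  have "(\<lambda>n. 1 - 2 * inverse (real n)) \<longlonglongrightarrow> 1 - 2 * 0"
    by (intro tendsto_intros LIMSEQ_inverse_real_of_nat lim_inverse_n)
  hence "(\<lambda>n. 1 - 2 * inverse (real n)) \<longlonglongrightarrow> 1" by simp
  moreover have "\<forall>\<^sub>F n in sequentially. 1 - 2 * inverse (real n) = real (n - 2) / real n"
    using eventually_ge_at_top[of 2] by eventually_elim (simp add: field_simps of_nat_diff)
  ultimately show ?thesis by (rule Lim_transform_eventually)
qed

text \<open>The sums run over \<open>n - 2\<close> vertices while the limit hypotheses are scaled by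
  \<open>n\<close>; the ratio of the two tends to 1.\<close>

lemma tendsto_minus_2_times:
  fixes x :: "nat \<Rightarrow> 'a::real_normed_algebra_1"
  assumes "(\<lambda>n. of_real (real n) * x n) \<longlonglongrightarrow> c"
  shows "(\<lambda>n. of_real (real (n - 2)) * x n) \<longlonglongrightarrow> c"
proof -
  have "(\<lambda>n. (real (n - 2) / real n) *\<^sub>R (of_real (real n) * x n)) \<longlonglongrightarrow> 1 *\<^sub>R c"
    by (intro tendsto_scaleR tendsto_minus_2_ratio assms)
  hence "(\<lambda>n. (real (n - 2) / real n) *\<^sub>R (of_real (real n) * x n)) \<longlonglongrightarrow> c" by simp
  moreover have "\<forall>\<^sub>F n in sequentially.
      (real (n - 2) / real n) *\<^sub>R (of_real (real n) * x n) = of_real (real (n - 2)) * x n"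
    using eventually_ge_at_top[of 2]
  proof eventually_elim
    case (elim n)
    have "of_real (real (n - 2) / real n) * of_real (real n) = (of_real (real (n - 2)) :: 'a)"
      using elim unfolding of_real_mult[symmetric] by simp
    thus ?case by (simp add: scaleR_conv_of_real flip: mult.assoc)
  qed
  ultimately show ?thesis by (rule Lim_transform_eventually)
qed

text \<open>On 0/1 values the product is the indicator of a predicate, the form that the Poisson
  limit theorem takes.\<close>

lemma common_nbrs_eq_nbr_sum:
  "real (common_nbrs n i j G) = nbr_sum n i j (\<lambda>a b. of_bool (a \<noteq> 0 \<and> b \<noteq> 0)) G"
  unfolding common_nbrs_def nbr_sum_def of_nat_sum by (intro sum.cong) (auto simp: edge_ind_def)

text \<open>On 0/1 values the maximum minus the product is 1 exactly when the two values
  differ.\<close>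

lemma union_minus_common_nbrs_eq_nbr_sum:
  "real (union_nbrs n i j G) - real (common_nbrs n i j G) = nbr_sum n i j (\<lambda>a b. of_bool (a \<noteq> b)) G"
  unfolding common_nbrs_def union_nbrs_def nbr_sum_def of_nat_sum sum_subtractf[symmetric]
  by (intro sum.cong) (auto simp: edge_ind_def)

section \<open>Limits of the Jaccard index\<close>

text \<open>The vertices may vary with \<open>n\<close> and are valid only eventually, since even
  fixed ones lie in \<open>{1..n}\<close> only for large \<open>n\<close>.\<close>

locale erdos_renyi_sequence =
  fixes p :: "nat \<Rightarrow> real" and i j :: "nat \<Rightarrow> nat"
  assumes p_prob: "\<forall>n\<ge>2. 0 \<le> p n \<and> p n \<le> 1"
    and vertices: "\<forall>\<^sub>F n in sequentially. i n \<in> {1..n} \<and> j n \<in> {1..n} \<and> i n \<noteq> j n"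
begin

abbreviation "M \<equiv> \<lambda>n. erdos_renyi n (p n)"
abbreviation "S \<equiv> \<lambda>n G. real (common_nbrs n (i n) (j n) G)"
abbreviation "T \<equiv> \<lambda>n G. real (union_nbrs n (i n) (j n) G)"
abbreviation "J \<equiv> \<lambda>n. jaccard n (p n) (i n) (j n)"

section \<open>Normal and Poisson limits of neighbourhood sums\<close>

lemma eventually_valid:
  "\<forall>\<^sub>F n in sequentially. i n \<in> {1..n} \<and> j n \<in> {1..n} \<and> i n \<noteq> j n \<and> 0 \<le> p n \<and> p n \<le> 1 \<and> 2 \<le> n"
  using vertices eventually_ge_at_top[of 2] by eventually_elim (use p_prob in auto)

text \<open>The summand may depend on \<open>n\<close>, which accommodates the normalisation in the
  central limit theorem.\<close>

lemma conv_in_distr_nbr_sum: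
  fixes f :: "nat \<Rightarrow> nat \<Rightarrow> nat \<Rightarrow> real"
  assumes L: "real_distribution L"
    and lim: "\<And>t. (\<lambda>n. of_real (real n) * (edge_pair_mean (p n) (\<lambda>a b. iexp (t * f n a b)) - 1)) \<longlonglongrightarrow> w t"
    and char: "\<And>t. char L t = exp (w t)"
  shows "conv_in_distr M (\<lambda>n. nbr_sum n (i n) (j n) (f n)) L"
proof (rule conv_in_distrI[OF L])
  fix t
  let ?a = "\<lambda>n. edge_pair_mean (p n) (\<lambda>a b. iexp (t * f n a b))"
  have "(\<lambda>n. ?a n ^ (n - 2)) \<longlonglongrightarrow> exp (w t)"
  proof (rule power_tendsto_exp)
    show "\<forall>\<^sub>F n in sequentially. norm (?a n) \<le> 1"
      using eventually_valid by eventually_elim (intro norm_edge_pair_mean_iexp_le_1, simp_all)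
    show "filterlim (\<lambda>n. n - 2 :: nat) at_top sequentially"
      by (rule filterlim_minus_const_nat_at_top)
    show "(\<lambda>n. of_nat (n - 2) * (?a n - 1)) \<longlonglongrightarrow> w t"
      using tendsto_minus_2_times[OF lim[of t]] by simp
  qed
  moreover have "\<forall>\<^sub>F n in sequentially. ?a n ^ (n - 2)
      = measure_pmf.expectation (M n) (\<lambda>G. iexp (t * nbr_sum n (i n) (j n) (f n) G))"
    using eventually_valid by eventually_elim (rule char_nbr_sum[symmetric], simp_all)
  ultimately show "(\<lambda>n. measure_pmf.expectation (M n) (\<lambda>G. iexp (t * nbr_sum n (i n) (j n) (f n) G))) \<longlonglongrightarrow> char L t"
    unfolding char by (rule Lim_transform_eventually)
qed

text \<open>A central limit theorem for triangular arrays with uniformly vanishing summands: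
  multiplied by \<open>n\<close>, the expansion error is at most
  \<open>\<bar>t\<bar> ^ 3 * B n / 6\<close>, because the variances are normalised to
  \<open>1 / n\<close>.\<close>

lemma conv_in_distr_nbr_sum_normal:
  fixes f :: "nat \<Rightarrow> nat \<Rightarrow> nat \<Rightarrow> real"
  assumes mean: "\<forall>\<^sub>F n in sequentially. edge_pair_mean (p n) (f n) = 0"
    and var: "\<forall>\<^sub>F n in sequentially. real n * edge_pair_mean (p n) (\<lambda>a b. (f n a b)\<^sup>2) = 1"
    and bd: "\<forall>\<^sub>F n in sequentially. \<forall>a\<in>{0, 1}. \<forall>b\<in>{0, 1}. \<bar>f n a b\<bar> \<le> B n"
    and B: "B \<longlonglongrightarrow> 0"
  shows "conv_in_distr M (\<lambda>n. nbr_sum n (i n) (j n) (f n)) std_normal_distribution"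
proof (rule conv_in_distr_nbr_sum[OF real_dist_normal_dist, where w = "\<lambda>t. of_real (- t\<^sup>2 / 2)"])
  fix t :: real
  let ?a = "\<lambda>n. edge_pair_mean (p n) (\<lambda>a b. iexp (t * f n a b))"
  have "\<forall>\<^sub>F n in sequentially. norm (of_real (real n) * (?a n - 1) - of_real (- t\<^sup>2 / 2)) \<le> \<bar>t\<bar> ^ 3 * B n / 6"
    using mean var bd eventually_valid
  proof eventually_elim
    case (elim n)
    let ?v = "edge_pair_mean (p n) (\<lambda>a b. (f n a b)\<^sup>2)"
    have "of_real (real n) * (?a n - 1) - of_real (- t\<^sup>2 / 2)
        = of_real (real n) * (?a n - 1) + of_real (t\<^sup>2 / 2 * (real n * ?v))"
      by (simp add: elim(2))
    also have "\<dots> = of_real (real n) * (?a n - 1 + of_real (t\<^sup>2 * ?v / 2))"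
      by (simp add: algebra_simps)
    finally have "norm (of_real (real n) * (?a n - 1) - of_real (- t\<^sup>2 / 2))
        = real n * norm (?a n - 1 + of_real (t\<^sup>2 * ?v / 2))"
      by (simp only: norm_mult norm_of_real abs_of_nat)
    also have "\<dots> \<le> real n * (\<bar>t\<bar> ^ 3 * B n / 6 * ?v)"
      using elim by (intro mult_left_mono edge_pair_mean_iexp_approx) auto
    also have "\<dots> = \<bar>t\<bar> ^ 3 * B n / 6 * (real n * ?v)" by simp
    finally show ?case unfolding elim(2) by simp
  qed
  moreover have "(\<lambda>n. \<bar>t\<bar> ^ 3 * B n / 6) \<longlonglongrightarrow> 0"
    using tendsto_divide[OF tendsto_mult[OF tendsto_const[of "\<bar>t\<bar> ^ 3"] B] tendsto_const[of 6]] by simp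
  ultimately show "(\<lambda>n. of_real (real n) * (?a n - 1)) \<longlonglongrightarrow> of_real (- t\<^sup>2 / 2)"
    by (subst LIM_zero_iff[symmetric]) (rule Lim_null_comparison)
qed (simp only: char_std_normal_distribution exp_of_real)

text \<open>For an indicator of probability \<open>r\<close> the characteristic function is exactly
  \<open>1 + r * (iexp t - 1)\<close>, so only the limit of \<open>n * r\<close> enters.\<close>

lemma conv_in_distr_nbr_sum_poisson:
  assumes \<mu>: "\<mu> > 0"
    and lim: "(\<lambda>n. real n * edge_pair_mean (p n) (\<lambda>a b. of_bool (Q a b))) \<longlonglongrightarrow> \<mu>"
  shows "conv_in_distr M (\<lambda>n. nbr_sum n (i n) (j n) (\<lambda>a b. of_bool (Q a b))) (poisson_law \<mu>)"
proof (rule conv_in_distr_nbr_sum[OF real_distribution_poisson_law])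
  fix t :: real
  have "edge_pair_mean (p n) (\<lambda>a b. iexp (t * of_bool (Q a b))) - 1
      = of_real (edge_pair_mean (p n) (\<lambda>a b. of_bool (Q a b))) * (iexp t - 1)" for n
  proof -
    have "edge_pair_mean (p n) (\<lambda>a b. iexp (t * of_bool (Q a b)))
        = edge_pair_mean (p n) (\<lambda>a b. 1 + (iexp t - 1) * of_real (of_bool (Q a b)))"
      unfolding edge_pair_mean_def by (simp add: of_bool_def)
    thus ?thesis
      unfolding edge_pair_mean_add edge_pair_mean_cmult edge_pair_mean_of_real by simp
  qed
  moreover have "(\<lambda>n. of_real (real n * edge_pair_mean (p n) (\<lambda>a b. of_bool (Q a b))) * (iexp t - 1))
      \<longlonglongrightarrow> of_real \<mu> * (iexp t - 1)"
    by (intro tendsto_intros lim)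
  ultimately show "(\<lambda>n. of_real (real n) * (edge_pair_mean (p n) (\<lambda>a b. iexp (t * of_bool (Q a b))) - 1))
      \<longlonglongrightarrow> of_real \<mu> * (iexp t - 1)"
    by (simp add: mult.assoc)
qed (rule char_poisson_law[OF \<mu>])

section \<open>First-moment bounds and replacing the union size by its approximate mean\<close>

lemma nbr_sum_of_bool_nonneg: "nbr_sum n k l (\<lambda>a b. of_bool (Q a b)) G \<ge> (0::real)"
  unfolding nbr_sum_def by (intro sum_nonneg) simp

lemma tendsto_expectation_nbr_sum:
  fixes f :: "nat \<Rightarrow> nat \<Rightarrow> real"
  assumes "(\<lambda>n. real n * edge_pair_mean (p n) f) \<longlonglongrightarrow> \<mu>"
  shows "(\<lambda>n. measure_pmf.expectation (M n) (nbr_sum n (i n) (j n) f)) \<longlonglongrightarrow> \<mu>"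
proof (rule Lim_transform_eventually)
  show "(\<lambda>n. real (n - 2) * edge_pair_mean (p n) f) \<longlonglongrightarrow> \<mu>"
    using tendsto_minus_2_times[of "\<lambda>n. edge_pair_mean (p n) f" \<mu>] assms by simp
  show "\<forall>\<^sub>F n in sequentially.
      real (n - 2) * edge_pair_mean (p n) f = measure_pmf.expectation (M n) (nbr_sum n (i n) (j n) f)"
    using eventually_valid by eventually_elim (simp add: expectation_nbr_sum)
qed

text \<open>The first-moment method: an integer is nonzero only if its modulus exceeds
  \<open>1 / 2\<close>, and Markov's inequality at that threshold gives the factor 2.\<close>

lemma prob_nbr_sum_nonzero:
  assumes "(\<lambda>n. real n * edge_pair_mean (p n) (\<lambda>a b. of_bool (Q a b))) \<longlonglongrightarrow> 0"
  shows "(\<lambda>n. measure_pmf.prob (M n) {G. nbr_sum n (i n) (j n) (\<lambda>a b. of_bool (Q a b)) G \<noteq> (0::real)}) \<longlonglongrightarrow> 0"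
proof -
  let ?X = "\<lambda>n. nbr_sum n (i n) (j n) (\<lambda>a b. of_bool (Q a b)) :: _ \<Rightarrow> real"
  have bd: "norm (measure_pmf.prob (M n) {G. ?X n G \<noteq> 0}) \<le> 2 * measure_pmf.expectation (M n) (?X n)" for n
  proof -
    have "{G. ?X n G \<noteq> 0} \<subseteq> {G. \<bar>?X n G\<bar> > 1 / 2}"
    proof (safe, rule ccontr)
      fix G assume "?X n G \<noteq> 0" "\<not> \<bar>?X n G\<bar> > 1 / 2"
      moreover have "?X n G \<in> \<int>" unfolding nbr_sum_def by (intro Ints_sum) auto
      ultimately show False by (auto elim!: Ints_cases)
    qed
    hence "measure_pmf.prob (M n) {G. ?X n G \<noteq> 0} \<le> measure_pmf.prob (M n) {G. \<bar>?X n G\<bar> > 1 / 2}"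
      by (intro measure_pmf.finite_measure_mono) auto
    also have "\<dots> \<le> measure_pmf.expectation (M n) (\<lambda>G. \<bar>?X n G\<bar>) / (1 / 2)"
      by (rule pmf_markov[OF integrable_erdos_renyi]) simp
    finally show ?thesis
      by (simp add: nbr_sum_of_bool_nonneg)
  qed
  have "(\<lambda>n. 2 * measure_pmf.expectation (M n) (?X n)) \<longlonglongrightarrow> 0"
    using tendsto_mult[OF tendsto_const[of 2] tendsto_expectation_nbr_sum[OF assms]] by simp
  thus ?thesis
    by (rule Lim_null_comparison[OF always_eventually[OF allI[OF bd]]])
qed

text \<open>Any \<open>a\<close> asymptotic to the mean of \<open>T\<close> serves, so each regime
  can use its own scale: the mean up to replacing \<open>n - 2\<close> by \<open>n\<close>, or
  \<open>2 * n * p\<close>, or \<open>n\<close>.\<close>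

lemma union_nbrs_conv_in_prob:
  assumes a: "filterlim a at_top sequentially"
    and ratio: "(\<lambda>n. real n * (p n * (2 - p n)) / a n) \<longlonglongrightarrow> 1"
  shows "conv_in_prob M (\<lambda>n G. T n G / a n) 1"
proof (rule conv_in_prob_second_moment[OF integrable_erdos_renyi])
  let ?m = "\<lambda>n. real (n - 2) * (p n * (2 - p n)) / a n"
  have "?m \<longlonglongrightarrow> 1"
    using tendsto_minus_2_times[of "\<lambda>n. p n * (2 - p n) / a n" 1] ratio by simp
  moreover have "(\<lambda>n. inverse (a n)) \<longlonglongrightarrow> 0"
    by (rule tendsto_inverse_0_at_top[OF a])
  ultimately have "(\<lambda>n. ?m n * inverse (a n) + (?m n - 1)\<^sup>2) \<longlonglongrightarrow> 1 * 0 + (1 - 1)\<^sup>2"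
    by (intro tendsto_intros)
  hence lim: "(\<lambda>n. ?m n * inverse (a n) + (?m n - 1)\<^sup>2) \<longlonglongrightarrow> 0" by simp
  have "\<forall>\<^sub>F n in sequentially. norm (measure_pmf.expectation (M n) (\<lambda>G. (T n G / a n - 1)\<^sup>2))
      \<le> ?m n * inverse (a n) + (?m n - 1)\<^sup>2"
    using eventually_valid filterlim_at_top_dense[THEN iffD1, OF a, THEN spec, of 0]
  proof eventually_elim
    case (elim n)
    thus ?case
      using second_moment_union_nbrs[of "i n" n "j n" "p n" "a n"] by simp
  qed
  thus "(\<lambda>n. measure_pmf.expectation (M n) (\<lambda>G. (T n G / a n - 1)\<^sup>2)) \<longlonglongrightarrow> 0"
    by (rule Lim_null_comparison[OF _ lim])
qed

text \<open>Since \<open>T / a\<close> tends to 1 in probability, so does \<open>a / T\<close>, and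
  the product form of Slutsky's theorem applies. The convention for \<open>T = 0\<close> has no
  effect in the limit: there \<open>T / a\<close> is at distance 1 from 1.\<close>

lemma conv_in_distr_via_union_nbrs:
  assumes a: "filterlim a at_top sequentially"
    and ratio: "(\<lambda>n. real n * (p n * (2 - p n)) / a n) \<longlonglongrightarrow> 1"
    and L: "real_distribution L" and X: "conv_in_distr M X L"
    and bd: "\<forall>\<^sub>F n in sequentially. measure_pmf.expectation (M n) (\<lambda>G. \<bar>X n G\<bar>) \<le> C"
    and eq: "\<forall>\<^sub>F n in sequentially. \<forall>G. T n G > 0 \<longrightarrow> Y n G = X n G * (a n / T n G)"
  shows "conv_in_distr M Y L"
proof (rule conv_in_distr_mult[OF L X integrable_erdos_renyi bd])
  note R = union_nbrs_conv_in_prob[OF a ratio]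
  show "conv_in_prob M (\<lambda>n G. inverse (T n G / a n)) 1"
    by (rule conv_in_prob_inverse_1[OF R])
  have half: "(\<lambda>n. measure_pmf.prob (M n) {G. \<bar>T n G / a n - 1\<bar> > 1 / 2}) \<longlonglongrightarrow> 0"
    using R[unfolded conv_in_prob_def, rule_format, of "1 / 2"] by simp
  have "measure_pmf.prob (M n) {G. T n G = 0} \<le> measure_pmf.prob (M n) {G. \<bar>T n G / a n - 1\<bar> > 1 / 2}" for n
    by (intro measure_pmf.finite_measure_mono) auto
  thus "(\<lambda>n. measure_pmf.prob (M n) {G. T n G = 0}) \<longlonglongrightarrow> 0"
    by (intro Lim_null_comparison[OF always_eventually half] allI)
       (simp only: real_norm_def abs_of_nonneg[OF measure_nonneg])
  show "\<forall>\<^sub>F n in sequentially. \<forall>G. G \<notin> {G. T n G = 0} \<longrightarrow> Y n G = X n G * inverse (T n G / a n)"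
    using eq by eventually_elim auto
qed

text \<open>For counts the required L1 bound is automatic: the absolute value is the count itself,
  and its mean tends to \<open>\<mu>\<close>.\<close>

lemma conv_in_distr_poisson_via_union_nbrs:
  assumes a: "filterlim a at_top sequentially"
    and ratio: "(\<lambda>n. real n * (p n * (2 - p n)) / a n) \<longlonglongrightarrow> 1"
    and \<mu>: "\<mu> > 0"
    and lim: "(\<lambda>n. real n * edge_pair_mean (p n) (\<lambda>a b. of_bool (Q a b))) \<longlonglongrightarrow> \<mu>"
    and eq: "\<forall>\<^sub>F n in sequentially. \<forall>G. T n G > 0 \<longrightarrow>
      Y n G = nbr_sum n (i n) (j n) (\<lambda>a b. of_bool (Q a b)) G * (a n / T n G)"
  shows "conv_in_distr M Y (poisson_law \<mu>)"
proof (rule conv_in_distr_via_union_nbrs[OF a ratio real_distribution_poisson_law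
      conv_in_distr_nbr_sum_poisson[OF \<mu> lim] _ eq])
  show "\<forall>\<^sub>F n in sequentially. measure_pmf.expectation (M n)
      (\<lambda>G. \<bar>nbr_sum n (i n) (j n) (\<lambda>a b. of_bool (Q a b)) G\<bar>) \<le> \<mu> + 1"
    using order_tendstoD(2)[OF tendsto_expectation_nbr_sum[OF lim], of "\<mu> + 1"]
    by (simp add: nbr_sum_of_bool_nonneg eventually_mono less_imp_le)
qed

section \<open>The five regimes\<close>

lemma jaccard_normal:
  assumes lim: "filterlim (\<lambda>n. real n * (p n)\<^sup>2 * (1 - p n)) at_top sequentially"
  shows "conv_in_distr M (\<lambda>n G. sqrt (real n * (2 - p n) ^ 3 / (2 * (1 - p n))) * (J n G - p n / (2 - p n)))
    std_normal_distribution"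
proof -
  \<comment> \<open>\<open>(s n)\<^sup>2\<close> is \<open>n\<close> times the variance of a summand
    of \<open>S - q T\<close>, with \<open>q = p / (2 - p)\<close>. Using \<open>n\<close> instead
    of \<open>n - 2\<close> makes the scaled variance exactly 1.\<close>
  define s where "s n = sqrt (real n * (2 * (p n)\<^sup>2 * (1 - p n) / (2 - p n)))" for n
  define f where "f n a b = (real (a * b) - p n / (2 - p n) * real (max a b)) / s n" for n a b :: nat
  let ?a = "\<lambda>n. real n * (p n * (2 - p n))"
  let ?X = "\<lambda>n. nbr_sum n (i n) (j n) (f n)"
  \<comment> \<open>At \<open>p n = 0\<close> or \<open>p n = 1\<close> the quantity assumed to
    diverge is 0, so both are eventually excluded.\<close>
  have ev: "\<forall>\<^sub>F n in sequentially. n > 0 \<and> p n > 0 \<and> p n < 1"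
    using eventually_valid filterlim_at_top_dense[THEN iffD1, OF lim, THEN spec, of 0]
  proof eventually_elim
    case (elim n)
    thus ?case by (cases "p n = 0"; cases "p n = 1") auto
  qed
  have s_ge: "\<forall>\<^sub>F n in sequentially. sqrt (real n * (p n)\<^sup>2 * (1 - p n)) \<le> s n"
    using ev
  proof eventually_elim
    case (elim n)
    have "1 \<le> 2 / (2 - p n)" using elim by simp
    hence "real n * (p n)\<^sup>2 * (1 - p n) * 1 \<le> real n * (p n)\<^sup>2 * (1 - p n) * (2 / (2 - p n))"
      using elim by (intro mult_left_mono) auto
    thus ?case unfolding s_def by (intro real_sqrt_le_mono) (simp add: mult_ac)
  qed
  have s_lim: "filterlim s at_top sequentially"
    by (rule filterlim_at_top_mono[OF filterlim_compose[OF sqrt_at_top lim] s_ge])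
  have s_pos: "\<forall>\<^sub>F n in sequentially. s n > 0"
    using s_lim by (simp add: filterlim_at_top_dense)
  have s_sq: "\<forall>\<^sub>F n in sequentially. (s n)\<^sup>2 = real n * (2 * (p n)\<^sup>2 * (1 - p n) / (2 - p n))"
    using ev by eventually_elim (auto simp: s_def)
  have mean: "\<forall>\<^sub>F n in sequentially. edge_pair_mean (p n) (f n) = 0"
    using ev
  proof eventually_elim
    case (elim n)
    define q where "q = p n / (2 - p n)"
    have "edge_pair_mean (p n) (f n) = (p n * p n - p n * (q * (2 - p n))) / s n"
      by (simp add: edge_pair_mean_def f_def q_def[symmetric] divide_simps power2_eq_square)
         (simp add: algebra_simps)
    also have "q * (2 - p n) = p n"
      using elim by (simp add: q_def)
    finally show ?case by simp
  qed
  have var: "\<forall>\<^sub>F n in sequentially. real n * edge_pair_mean (p n) (\<lambda>a b. (f n a b)\<^sup>2) = 1"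
    using ev s_pos s_sq
  proof eventually_elim
    case (elim n)
    define q where "q = p n / (2 - p n)"
    \<comment> \<open>The unscaled summand is \<open>- q\<close> when exactly one edge is present,
      \<open>1 - q\<close> when both are, and 0 otherwise.\<close>
    have "edge_pair_mean (p n) (\<lambda>a b. (f n a b)\<^sup>2)
        = (2 * (p n * (1 - p n)) * q\<^sup>2 + (p n)\<^sup>2 * (1 - q)\<^sup>2) / (s n)\<^sup>2"
      by (simp add: edge_pair_mean_def f_def q_def[symmetric] power_divide add_divide_distrib)
    also have "1 - q = 2 * (1 - p n) / (2 - p n)"
      using elim by (simp add: q_def field_simps)
    also have "2 * (p n * (1 - p n)) * q\<^sup>2 + (p n)\<^sup>2 * (2 * (1 - p n) / (2 - p n))\<^sup>2
        = 2 * (p n)\<^sup>2 * (1 - p n) * (2 - p n) / (2 - p n)\<^sup>2"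
      unfolding q_def power_divide times_divide_eq_right add_divide_distrib[symmetric]
      by (simp add: power2_eq_square algebra_simps)
    also have "\<dots> = 2 * (p n)\<^sup>2 * (1 - p n) / (2 - p n)"
      by (simp add: power2_eq_square)
    finally show ?case
      using elim by (simp add: elim(3))
  qed
  have bd: "\<forall>\<^sub>F n in sequentially. \<forall>a\<in>{0, 1}. \<forall>b\<in>{0, 1}. \<bar>f n a b\<bar> \<le> inverse (s n)"
    using ev s_pos
  proof eventually_elim
    case (elim n)
    define q where "q = p n / (2 - p n)"
    have "0 \<le> q" "q \<le> 1"
      using elim by (auto simp: q_def)
    hence "\<bar>real (a * b) - q * real (max a b)\<bar> \<le> 1" if "a \<in> {0, 1}" "b \<in> {0, 1}" for a b :: nat
      using that by auto
    thus ?case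
      using elim(2) unfolding f_def abs_divide q_def[symmetric]
      by (simp add: divide_inverse mult_left_le_one_le)
  qed
  have X: "conv_in_distr M ?X std_normal_distribution"
    by (rule conv_in_distr_nbr_sum_normal[OF mean var bd tendsto_inverse_0_at_top[OF s_lim]])
  have a_lim: "filterlim ?a at_top sequentially"
  proof (rule filterlim_at_top_mono[OF lim])
    show "\<forall>\<^sub>F n in sequentially. real n * (p n)\<^sup>2 * (1 - p n) \<le> ?a n"
      using ev
    proof eventually_elim
      case (elim n)
      \<comment> \<open>Both sides are compared through 1:
        \<open>p (1 - p) \<le> 1 \<le> 2 - p\<close>.\<close>
      have "p n * (1 - p n) \<le> 1 * 1" using elim by (intro mult_mono) auto
      hence "real n * p n * (p n * (1 - p n)) \<le> real n * p n * (2 - p n)"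
        using elim by (intro mult_left_mono) auto
      thus ?case by (simp add: power2_eq_square mult_ac)
    qed
  qed
  have a_pos: "\<forall>\<^sub>F n in sequentially. ?a n > 0"
    using a_lim by (simp only: filterlim_at_top_dense)
  have "(\<lambda>n. ?a n / ?a n) \<longlonglongrightarrow> 1"
    by (rule tendsto_eventually) (use a_pos in eventually_elim, rule divide_self, linarith)
  thus ?thesis
  proof (rule conv_in_distr_via_union_nbrs[OF a_lim _ real_dist_normal_dist X])
    \<comment> \<open>The constant 2 comes from \<open>\<bar>x\<bar> \<le> 1 + x\<^sup>2\<close> and
      a second moment of at most 1.\<close>
    show "\<forall>\<^sub>F n in sequentially. measure_pmf.expectation (M n) (\<lambda>G. \<bar>?X n G\<bar>) \<le> 2"
      using mean var eventually_valid
    proof eventually_elim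
      case (elim n)
      have "measure_pmf.expectation (M n) (\<lambda>G. \<bar>?X n G\<bar>) \<le> measure_pmf.expectation (M n) (\<lambda>G. 1 + (?X n G)\<^sup>2)"
      proof (intro integral_mono integrable_erdos_renyi)
        fix G
        have "0 \<le> (\<bar>?X n G\<bar> - 1)\<^sup>2 + (?X n G)\<^sup>2" by simp
        thus "\<bar>?X n G\<bar> \<le> 1 + (?X n G)\<^sup>2"
          unfolding power2_diff by simp
      qed
      also have "\<dots> = 1 + measure_pmf.expectation (M n) (\<lambda>G. (?X n G)\<^sup>2)"
        by (simp add: integrable_erdos_renyi)
      also have "measure_pmf.expectation (M n) (\<lambda>G. (?X n G)\<^sup>2)
          = real (n - 2) * edge_pair_mean (p n) (\<lambda>a b. (f n a b)\<^sup>2)"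
        using elim by (intro second_moment_nbr_sum) auto
      also have "\<dots> \<le> real n * edge_pair_mean (p n) (\<lambda>a b. (f n a b)\<^sup>2)"
        using elim edge_pair_mean_mono[of "p n" "\<lambda>_ _. 0" "\<lambda>a b. (f n a b)\<^sup>2"]
        by (intro mult_right_mono) auto
      finally show ?case using elim(2) by simp
    qed
    show "\<forall>\<^sub>F n in sequentially. \<forall>G. T n G > 0 \<longrightarrow>
        sqrt (real n * (2 - p n) ^ 3 / (2 * (1 - p n))) * (J n G - p n / (2 - p n)) = ?X n G * (?a n / T n G)"
      using ev s_pos s_sq
    proof (eventually_elim, safe)
      fix n G
      assume n: "0 < n" "0 < p n" "p n < 1" "0 < s n" "0 < T n G"
        and sq: "(s n)\<^sup>2 = real n * (2 * (p n)\<^sup>2 * (1 - p n) / (2 - p n))"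
      \<comment> \<open>The prescribed scaling is the approximate mean of \<open>T\<close> divided
        by \<open>s n\<close>, so it turns \<open>(S - q T) / T\<close> into the normalised sum
        times a factor tending to 1.\<close>
      have "sqrt (real n * (2 - p n) ^ 3 / (2 * (1 - p n))) = ?a n / s n"
      proof (rule real_sqrt_unique)
        show "(?a n / s n)\<^sup>2 = real n * (2 - p n) ^ 3 / (2 * (1 - p n))"
          using n unfolding power_divide sq
          by (simp add: divide_simps) (simp add: power2_eq_square power3_eq_cube)
      qed (use n in auto)
      moreover have "?X n G = (S n G - p n / (2 - p n) * T n G) / s n"
        by (simp add: nbr_sum_def f_def common_nbrs_def union_nbrs_def sum_divide_distrib sum_distrib_left
            flip: sum_subtractf)
      moreover have "J n G - p n / (2 - p n) = (S n G - p n / (2 - p n) * T n G) / T n G"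
        using n by (simp add: jaccard_def diff_divide_distrib)
      ultimately show "sqrt (real n * (2 - p n) ^ 3 / (2 * (1 - p n))) * (J n G - p n / (2 - p n))
          = ?X n G * (?a n / T n G)"
        by simp
    qed
  qed
qed

text \<open>Here \<open>2 n p J = S * (2 n p / T)\<close>. The count \<open>S\<close> has success
  probability \<open>p\<^sup>2\<close>, hence the Poisson limit; and \<open>p\<close> tends to 0, so
  the mean of \<open>T\<close> is asymptotic to \<open>2 n p\<close>.\<close>

lemma jaccard_sparse_poisson:
  assumes \<mu>: "\<mu> > 0" and lim: "(\<lambda>n. real n * (p n)\<^sup>2) \<longlonglongrightarrow> \<mu>"
  shows "conv_in_distr M (\<lambda>n G. 2 * real n * p n * J n G) (poisson_law \<mu>)"
proof (rule conv_in_distr_poisson_via_union_nbrs[OF _ _ \<mu>, where Q = "\<lambda>a b. a \<noteq> 0 \<and> b \<noteq> 0"])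
  have p_ev: "\<forall>\<^sub>F n in sequentially. n > 0 \<and> p n > 0"
    using eventually_valid order_tendstoD(1)[OF lim \<mu>]
  proof eventually_elim
    case (elim n)
    thus ?case by (cases "p n = 0") auto
  qed
  have "(\<lambda>n. real n * (p n)\<^sup>2 * inverse (real n)) \<longlonglongrightarrow> \<mu> * 0"
    by (intro tendsto_mult lim lim_inverse_n)
  moreover have "\<forall>\<^sub>F n in sequentially. real n * (p n)\<^sup>2 * inverse (real n) = (p n)\<^sup>2"
    using p_ev by eventually_elim simp
  ultimately have "(\<lambda>n. (p n)\<^sup>2) \<longlonglongrightarrow> \<mu> * 0"
    by (rule Lim_transform_eventually)
  hence p0: "p \<longlonglongrightarrow> 0" by simp
  \<comment> \<open>Divergence of \<open>n p\<close> is read off from its square, \<open>n\<close>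
    times a quantity with a positive limit.\<close>
  have "filterlim (\<lambda>n. real n * (p n)\<^sup>2 * real n) at_top sequentially"
    by (rule filterlim_tendsto_pos_mult_at_top[OF lim \<mu> filterlim_real_sequentially])
  hence "filterlim (\<lambda>n. sqrt (real n * (p n)\<^sup>2 * real n)) at_top sequentially"
    by (rule filterlim_compose[OF sqrt_at_top])
  thus "filterlim (\<lambda>n. 2 * real n * p n) at_top sequentially"
  proof (rule filterlim_at_top_mono)
    show "\<forall>\<^sub>F n in sequentially. sqrt (real n * (p n)\<^sup>2 * real n) \<le> 2 * real n * p n"
      using p_ev
    proof eventually_elim
      case (elim n)
      have "real n * (p n)\<^sup>2 * real n = (real n * p n)\<^sup>2" by (simp add: power2_eq_square)
      thus ?case using elim by simp
    qed
  qed
  have "(\<lambda>n. (2 - p n) / 2) \<longlonglongrightarrow> (2 - 0) / 2"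
    by (intro tendsto_intros p0) simp
  hence "(\<lambda>n. (2 - p n) / 2) \<longlonglongrightarrow> 1" by simp
  moreover have "\<forall>\<^sub>F n in sequentially. (2 - p n) / 2 = real n * (p n * (2 - p n)) / (2 * real n * p n)"
    using p_ev by eventually_elim simp
  ultimately show "(\<lambda>n. real n * (p n * (2 - p n)) / (2 * real n * p n)) \<longlonglongrightarrow> 1"
    by (rule Lim_transform_eventually)
  show "(\<lambda>n. real n * edge_pair_mean (p n) (\<lambda>a b. of_bool (a \<noteq> 0 \<and> b \<noteq> 0))) \<longlonglongrightarrow> \<mu>"
    using lim by (simp add: edge_pair_mean_def)
  show "\<forall>\<^sub>F n in sequentially. \<forall>G. T n G > 0 \<longrightarrow> 2 * real n * p n * J n G
      = nbr_sum n (i n) (j n) (\<lambda>a b. of_bool (a \<noteq> 0 \<and> b \<noteq> 0)) G * (2 * real n * p n / T n G)"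
    unfolding common_nbrs_eq_nbr_sum[symmetric] by (simp add: jaccard_def)
qed

text \<open>With high probability \<open>S = 0\<close>. Then \<open>J\<close> is 0 or, if also
  \<open>T = 0\<close>, the conventional \<open>p / (2 - p) \<le> p\<close>; either way
  \<open>n p J\<close> is at most the null sequence \<open>n p\<^sup>2\<close>.\<close>

lemma jaccard_sparse_null:
  assumes lim: "(\<lambda>n. real n * (p n)\<^sup>2) \<longlonglongrightarrow> 0"
  shows "conv_in_prob M (\<lambda>n G. real n * p n * J n G) 0"
proof (rule conv_in_prob_squeeze[OF _ conv_in_prob_const[OF lim]])
  show "(\<lambda>n. measure_pmf.prob (M n) {G. S n G \<noteq> 0}) \<longlonglongrightarrow> 0"
    unfolding common_nbrs_eq_nbr_sum
    by (rule prob_nbr_sum_nonzero) (use lim in \<open>simp add: edge_pair_mean_def\<close>)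
  show "\<forall>\<^sub>F n in sequentially. \<forall>G. G \<notin> {G. S n G \<noteq> 0} \<longrightarrow> \<bar>real n * p n * J n G - 0\<bar> \<le> \<bar>real n * (p n)\<^sup>2\<bar>"
    using eventually_valid
  proof (eventually_elim, intro allI impI)
    fix n G
    assume n: "i n \<in> {1..n} \<and> j n \<in> {1..n} \<and> i n \<noteq> j n \<and> 0 \<le> p n \<and> p n \<le> 1 \<and> 2 \<le> n"
      and "G \<notin> {G. S n G \<noteq> 0}"
    hence "J n G = 0 \<or> J n G = p n / (2 - p n)" by (auto simp: jaccard_def)
    moreover have "0 \<le> p n / (2 - p n)" using n by simp
    moreover have "p n / (2 - p n) \<le> p n / 1" using n by (intro divide_left_mono) auto
    ultimately have J: "0 \<le> J n G" "J n G \<le> p n" using n by auto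
    hence "real n * p n * J n G \<le> real n * p n * p n" using n by (intro mult_left_mono) auto
    thus "\<bar>real n * p n * J n G - 0\<bar> \<le> \<bar>real n * (p n)\<^sup>2\<bar>"
      using n J by (simp add: abs_mult power2_eq_square)
  qed
qed

text \<open>Here \<open>n (1 - J) = (T - S) * (n / T)\<close>. A vertex is adjacent to exactly one
  of \<open>i\<close>, \<open>j\<close> with probability \<open>2 p (1 - p)\<close>, whence the
  parameter \<open>2 * c\<close> as \<open>p\<close> tends to 1; and the mean of \<open>T\<close> is
  asymptotic to \<open>n\<close>.\<close>

lemma jaccard_dense_poisson:
  assumes c: "c > 0" and lim: "(\<lambda>n. real n * (1 - p n)) \<longlonglongrightarrow> c"
  shows "conv_in_distr M (\<lambda>n G. real n * (1 - J n G)) (poisson_law (2 * c))"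
proof (rule conv_in_distr_poisson_via_union_nbrs[OF filterlim_real_sequentially, where Q = "(\<noteq>)"])
  have "(\<lambda>n. real n * (1 - p n) * inverse (real n)) \<longlonglongrightarrow> c * 0"
    by (intro tendsto_mult lim lim_inverse_n)
  moreover have "\<forall>\<^sub>F n in sequentially. real n * (1 - p n) * inverse (real n) = 1 - p n"
    using eventually_gt_at_top[of 0] by eventually_elim simp
  ultimately have "(\<lambda>n. 1 - p n) \<longlonglongrightarrow> c * 0"
    by (rule Lim_transform_eventually)
  from tendsto_diff[OF tendsto_const[of 1] this] have p1: "p \<longlonglongrightarrow> 1" by simp
  have "(\<lambda>n. p n * (2 - p n)) \<longlonglongrightarrow> 1 * (2 - 1)"
    by (intro tendsto_intros p1)
  hence "(\<lambda>n. p n * (2 - p n)) \<longlonglongrightarrow> 1" by simp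
  moreover have "\<forall>\<^sub>F n in sequentially. p n * (2 - p n) = real n * (p n * (2 - p n)) / real n"
    using eventually_gt_at_top[of 0] by eventually_elim simp
  ultimately show "(\<lambda>n. real n * (p n * (2 - p n)) / real n) \<longlonglongrightarrow> 1"
    by (rule Lim_transform_eventually)
  have "(\<lambda>n. 2 * p n * (real n * (1 - p n))) \<longlonglongrightarrow> 2 * 1 * c"
    by (intro tendsto_intros p1 lim)
  thus "(\<lambda>n. real n * edge_pair_mean (p n) (\<lambda>a b. of_bool (a \<noteq> b))) \<longlonglongrightarrow> 2 * c"
    by (simp add: edge_pair_mean_def mult_ac)
  show "\<forall>\<^sub>F n in sequentially. \<forall>G. T n G > 0 \<longrightarrow>
      real n * (1 - J n G) = nbr_sum n (i n) (j n) (\<lambda>a b. of_bool (a \<noteq> b)) G * (real n / T n G)"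
    unfolding union_minus_common_nbrs_eq_nbr_sum[symmetric] by (simp add: jaccard_def field_simps)
qed (use c in simp)

text \<open>With high probability \<open>S = T\<close>, so \<open>J\<close> is 1 or, if
  \<open>T = 0\<close>, the conventional value. The latter is within \<open>2 (1 - p)\<close> of 1,
  so \<open>n (1 - J)\<close> is bounded by a null sequence in both cases.\<close>

lemma jaccard_dense_null:
  assumes lim: "(\<lambda>n. real n * (1 - p n)) \<longlonglongrightarrow> 0"
  shows "conv_in_prob M (\<lambda>n G. real n * (1 - J n G)) 0"
proof -
  have lim2: "(\<lambda>n. 2 * (real n * (1 - p n))) \<longlonglongrightarrow> 0"
    using tendsto_mult[OF tendsto_const[of 2] lim] by simp
  show ?thesis
  proof (rule conv_in_prob_squeeze[OF _ conv_in_prob_const[OF lim2]])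
    have "(\<lambda>n. real n * edge_pair_mean (p n) (\<lambda>a b. of_bool (a \<noteq> b))) \<longlonglongrightarrow> 0"
    proof (rule Lim_null_comparison[OF _ lim2])
      show "\<forall>\<^sub>F n in sequentially. norm (real n * edge_pair_mean (p n) (\<lambda>a b. of_bool (a \<noteq> b)))
          \<le> 2 * (real n * (1 - p n))"
        using eventually_valid
      proof eventually_elim
        case (elim n)
        have "2 * (real n * (1 - p n)) * p n \<le> 2 * (real n * (1 - p n)) * 1"
          using elim by (intro mult_left_mono) auto
        thus ?case using elim by (simp add: edge_pair_mean_def abs_mult mult_ac)
      qed
    qed
    from prob_nbr_sum_nonzero[OF this]
    show "(\<lambda>n. measure_pmf.prob (M n) {G. T n G - S n G \<noteq> 0}) \<longlonglongrightarrow> 0"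
      unfolding union_minus_common_nbrs_eq_nbr_sum .
    show "\<forall>\<^sub>F n in sequentially. \<forall>G. G \<notin> {G. T n G - S n G \<noteq> 0} \<longrightarrow>
        \<bar>real n * (1 - J n G) - 0\<bar> \<le> \<bar>2 * (real n * (1 - p n))\<bar>"
      using eventually_valid
    proof (eventually_elim, intro allI impI)
      fix n G
      assume n: "i n \<in> {1..n} \<and> j n \<in> {1..n} \<and> i n \<noteq> j n \<and> 0 \<le> p n \<and> p n \<le> 1 \<and> 2 \<le> n"
        and "G \<notin> {G. T n G - S n G \<noteq> 0}"
      hence "J n G = 1 \<or> J n G = p n / (2 - p n)" by (auto simp: jaccard_def)
      moreover have "1 - p n / (2 - p n) = 2 * (1 - p n) / (2 - p n)" using n by (simp add: field_simps)
      moreover have "2 * (1 - p n) / (2 - p n) \<le> 2 * (1 - p n) / 1" "0 \<le> 2 * (1 - p n) / (2 - p n)"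
        using n by (intro divide_left_mono, auto)
      ultimately have J: "0 \<le> 1 - J n G" "1 - J n G \<le> 2 * (1 - p n)" using n by auto
      hence "real n * (1 - J n G) \<le> real n * (2 * (1 - p n))" by (intro mult_left_mono) auto
      thus "\<bar>real n * (1 - J n G) - 0\<bar> \<le> \<bar>2 * (real n * (1 - p n))\<bar>"
        using n J by (simp add: abs_mult)
    qed
  qed
qed

end

theorem theorem1:
  fixes p :: "nat \<Rightarrow> real" and i j :: "nat \<Rightarrow> nat"
  assumes "\<forall>n\<ge>2. 0 \<le> p n \<and> p n \<le> 1"
    and "\<forall>\<^sub>F n in sequentially. i n \<in> {1..n} \<and> j n \<in> {1..n} \<and> i n \<noteq> j n"
  shows
    "(filterlim (\<lambda>n. real n * (p n)\<^sup>2 * (1 - p n)) at_top sequentially \<longrightarrow>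
        conv_in_distr (\<lambda>n. erdos_renyi n (p n))
          (\<lambda>n G. sqrt (real n * (2 - p n) ^ 3 / (2 * (1 - p n))) *
                   (jaccard n (p n) (i n) (j n) G - p n / (2 - p n)))
          std_normal_distribution) \<and>
     (\<forall>\<mu>::real. \<mu> > 0 \<and> (\<lambda>n. real n * (p n)\<^sup>2) \<longlonglongrightarrow> \<mu> \<longrightarrow>
        conv_in_distr (\<lambda>n. erdos_renyi n (p n))
          (\<lambda>n G. 2 * real n * p n * jaccard n (p n) (i n) (j n) G) (poisson_law \<mu>)) \<and>
     ((\<lambda>n. real n * (p n)\<^sup>2) \<longlonglongrightarrow> 0 \<longrightarrow>
        conv_in_prob (\<lambda>n. erdos_renyi n (p n))
          (\<lambda>n G. real n * p n * jaccard n (p n) (i n) (j n) G) 0) \<and>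
     (\<forall>c::real. c > 0 \<and> (\<lambda>n. real n * (1 - p n)) \<longlonglongrightarrow> c \<longrightarrow>
        conv_in_distr (\<lambda>n. erdos_renyi n (p n))
          (\<lambda>n G. real n * (1 - jaccard n (p n) (i n) (j n) G)) (poisson_law (2 * c))) \<and>
     ((\<lambda>n. real n * (1 - p n)) \<longlonglongrightarrow> 0 \<longrightarrow>
        conv_in_prob (\<lambda>n. erdos_renyi n (p n))
          (\<lambda>n G. real n * (1 - jaccard n (p n) (i n) (j n) G)) 0)"
proof -
  interpret erdos_renyi_sequence p i j
    using assms by unfold_locales
  show ?thesis
    using jaccard_normal jaccard_sparse_poisson jaccard_sparse_null jaccard_dense_poisson jaccard_dense_null
    by blast
qed

end
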